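(* Let $\kappa\in(0,4]$ and $\mathbf c=\frac{(6-\kappa)(3\kappa-8)}{2\kappa}$. Let $\mu^{\mathbf c}_{\hat{\mathbb C}}$ be the (one-loop) $\mathrm{SLE}_\kappa$ loop measure on simple loops in $\hat{\mathbb C}$, and for a domain $D\subset\hat{\mathbb C}$ let $\mu^{\mathbf c}_D$ be the corresponding loop measure in $D$. Let $\Lambda^*$ be the normalized Brownian loop measure. Then the measure on pairs of loops in $\hat{\mathbb C}$ defined by $$\mu^{\mathbf c}_{\hat{\mathbb C},2}(d\gamma_1,d\gamma_2)=\mathbf 1_{\{\gamma_1\cap\gamma_2=\emptyset\}}\;e^{\frac{\mathbf c}{2}\Lambda^*(\gamma_1,\gamma_2)}\;\mu^{\mathbf c}_{\hat{\mathbb C}}(d\gamma_1)\otimes\mu^{\mathbf c}_{\hat{\mathbb C}}(d\gamma_2)$$ is the unique conformally invariant (i.e. invariant under the Möbius transformations of $\hat{\mathbb C}$) measure on pairs of non-intersecting simple loops in $\hat{\mathbb C}$ which is absolutely continuous with respect to the product measure $\mu^{\mathbf c}_{\hat{\mathbb C}}\otimes\mu^{\mathbf c}_{\hat{\mathbb C}}$ and satisfies the cascade relation $$\mu^{\mathbf c}_{\hat{\mathbb C},2}(d\gamma_1,d\gamma_2)=\mu^{\mathbf c}_{\hat{\mathbb C}}(d\gamma_1)\otimes\sum_{D\in\pi_0(\hat{\mathbb C}\setminus\gamma_1)}\mu^{\mathbf c}_{D}(d\gamma_2).$$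
   Context: $\hat{\mathbb C}$ is the Riemann sphere, $\mathbb D$ the open unit disk. A simple loop is a subset $\gamma\subset\hat{\mathbb C}$ homeomorphic to the circle $S^1$; the space of simple loops carries the Hausdorff metric and its Borel $\sigma$-algebra. $\pi_0(X)$ is the set of connected components of $X$. Normalized Brownian loop measure: The Brownian loop measure (Lawler--Werner) is the measure on unrooted loops in $\mathbb C$ induced by the rooted measure $\int_{\mathbb C}\int_0^\infty \frac1t\cdot\frac{1}{2\pi t}\,\mathbb P^{br}_{z,t}\,dt\,dA(z)$, where $\mathbb P^{br}_{z,t}$ is the law of the planar Brownian bridge from $z$ to $z$ of duration $t$. For a domain $D$ and sets $V_1,V_2$, $\Lambda_D(V_1,V_2)$ is the total mass of Brownian loops contained in $D$ and intersecting both $V_1$ and $V_2$. For disjoint non-polar closed sets $V_1,V_2\subset\hat{\mathbb C}$, $\Lambda^*(V_1,V_2)=\lim_{R\to\infty}\big(\Lambda_{R\mathbb D}(V_1,V_2)-\log\log R\big)$; it is known that this limit is finite and Möbius invariant. One-loop $\mathrm{SLE}_\kappa$ measure: $\mu^{\mathbf c}_{\hat{\mathbb C}}$ is the $\mathrm{SLE}_\kappa$ loop measure on $\hat{\mathbb C}$ (constructed by Zhan), with a fixed choice of multiplicative normalization. For a domain $D\subset\hat{\mathbb C}$ the measure $\mu^{\mathbf c}_D$ is defined by restriction covariance, $$\frac{d\mu^{\mathbf c}_D}{d\mu^{\mathbf c}_{\hat{\mathbb C}}}(\gamma)=\mathbf 1_{\{\gamma\subset D\}}\,e^{\frac{\mathbf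 c}{2}\Lambda^*(\gamma,\hat{\mathbb C}\setminus D)} .$$ It is known that $\mu^{\mathbf c}_{\hat{\mathbb C}}$ is, up to a positive scalar, the unique nontrivial locally finite measure on simple loops in $\hat{\mathbb C}$ such that the measures $\mu^{\mathbf c}_D$ so defined are conformally invariant: for every conformal map $\psi:D_1\to D_2$ between domains of $\hat{\mathbb C}$, $\psi_*\mu^{\mathbf c}_{D_1}=\mu^{\mathbf c}_{D_2}$ (in particular $\mu^{\mathbf c}_{\hat{\mathbb C}}$ is Möbius invariant). *)

theory Defs
  imports "HOL-Probability.Probability" "HOL-Complex_Analysis.Complex_Analysis"
begin

section \<open>The Riemann sphere\<close>

datatype rsphere = Fin complex | Infty

text \<open>Stereographic projection onto the unit sphere of \<open>\<complex> \<times> \<real>\<close>; it induces the chordal metric.\<close>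

fun stereo :: "rsphere \<Rightarrow> complex \<times> real" where
  "stereo (Fin z) = ((2 / (1 + (cmod z)\<^sup>2)) *\<^sub>R z, ((cmod z)\<^sup>2 - 1) / ((cmod z)\<^sup>2 + 1))"
| "stereo Infty = (0, 1)"

lemma stereo_Fin_snd_neq: "((cmod z)\<^sup>2 - 1) / ((cmod z)\<^sup>2 + 1) \<noteq> 1"
proof -
  have "(cmod z)\<^sup>2 + 1 > 0"
    by (simp add: add_nonneg_pos)
  then show ?thesis
    by (simp add: field_simps)
qed

lemma inj_stereo: "inj stereo"
proof (rule injI)
  fix x y assume eq: "stereo x = stereo y"
  show "x = y"
  proof (cases x; cases y)
    fix z w assume x: "x = Fin z" and y: "y = Fin w"
    have pos: "(cmod z)\<^sup>2 + 1 > 0" "(cmod w)\<^sup>2 + 1 > 0"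
      by (simp_all add: add_nonneg_pos)
    have "((cmod z)\<^sup>2 - 1) / ((cmod z)\<^sup>2 + 1) = ((cmod w)\<^sup>2 - 1) / ((cmod w)\<^sup>2 + 1)"
      using eq x y by simp
    then have n: "(cmod z)\<^sup>2 = (cmod w)\<^sup>2"
      using pos by (simp add: field_simps)
    have "(2 / (1 + (cmod w)\<^sup>2)) *\<^sub>R z = (2 / (1 + (cmod w)\<^sup>2)) *\<^sub>R w"
      using eq x y n by simp
    moreover have "2 / (1 + (cmod w)\<^sup>2) \<noteq> 0"
      using pos(2) by simp
    ultimately have "z = w"
      by (metis scaleR_left_imp_eq)
    then show "x = y" using x y by simp
  qed (use eq stereo_Fin_snd_neq in auto)
qed

instantiation rsphere :: metric_space
begin

definition dist_rsphere :: "rsphere \<Rightarrow> rsphere \<Rightarrow> real" where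
  "dist_rsphere x y = dist (stereo x) (stereo y)"

definition uniformity_rsphere :: "(rsphere \<times> rsphere) filter" where
  "uniformity_rsphere = (INF e\<in>{0<..}. principal {(x, y). dist x y < e})"

definition open_rsphere :: "rsphere set \<Rightarrow> bool" where
  "open_rsphere U \<longleftrightarrow> (\<forall>x\<in>U. \<forall>\<^sub>F (x', y) in uniformity. x' = x \<longrightarrow> y \<in> U)"

instance
proof
  fix x y z :: rsphere and U :: "rsphere set"
  show "(uniformity :: (rsphere \<times> rsphere) filter)
      = (INF e\<in>{0<..}. principal {(x, y). dist x y < e})"
    by (fact uniformity_rsphere_def)
  show "open U \<longleftrightarrow> (\<forall>x\<in>U. \<forall>\<^sub>F (x', y) in uniformity. x' = x \<longrightarrow> y \<in> U)"
    by (fact open_rsphere_def)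
  show "dist x y = 0 \<longleftrightarrow> x = y"
    using inj_stereo by (auto simp: dist_rsphere_def inj_def)
  show "dist x y \<le> dist x z + dist y z"
    unfolding dist_rsphere_def by (rule dist_triangle2)
qed

end

definition rsphere_domain :: "rsphere set \<Rightarrow> bool" where
  "rsphere_domain D \<longleftrightarrow> open D \<and> connected D \<and> D \<noteq> {}"

fun inversion :: "rsphere \<Rightarrow> rsphere" where
  "inversion Infty = Fin 0"
| "inversion (Fin z) = (if z = 0 then Infty else Fin (1 / z))"

fun affine_part :: "rsphere \<Rightarrow> complex" where
  "affine_part (Fin z) = z"
| "affine_part Infty = 0"

text \<open>Holomorphy in the two charts \<open>z\<close> and \<open>1/z\<close>, both at the source (\<open>i\<close>) and at the target (\<open>j\<close>).
  The value of \<open>affine_part\<close> at \<open>Infty\<close> plays no role.\<close>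

definition rsphere_holomorphic_on :: "(rsphere \<Rightarrow> rsphere) \<Rightarrow> rsphere set \<Rightarrow> bool" where
  "rsphere_holomorphic_on f D \<longleftrightarrow> continuous_on D f \<and>
    (\<forall>i\<in>{id, inversion}. \<forall>j\<in>{id, inversion}.
      (\<lambda>z. affine_part (j (f (i (Fin z)))))
        holomorphic_on {z. i (Fin z) \<in> D \<and> j (f (i (Fin z))) \<noteq> Infty})"

definition conformal_map :: "rsphere set \<Rightarrow> rsphere set \<Rightarrow> (rsphere \<Rightarrow> rsphere) \<Rightarrow> bool" where
  "conformal_map D1 D2 \<psi> \<longleftrightarrow> bij_betw \<psi> D1 D2 \<and> rsphere_holomorphic_on \<psi> D1"

fun moebius_map :: "complex \<Rightarrow> complex \<Rightarrow> complex \<Rightarrow> complex \<Rightarrow> rsphere \<Rightarrow> rsphere" where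
  "moebius_map a b c d (Fin z) = (if c * z + d = 0 then Infty else Fin ((a * z + b) / (c * z + d)))"
| "moebius_map a b c d Infty = (if c = 0 then Infty else Fin (a / c))"

definition moebius_transformations :: "(rsphere \<Rightarrow> rsphere) set" where
  "moebius_transformations = {moebius_map a b c d | a b c d. a * d - b * c \<noteq> 0}"

section \<open>The space of simple loops\<close>

definition simple_loops :: "rsphere set set" where
  "simple_loops = {\<gamma>. \<gamma> homeomorphic sphere (0 :: complex) 1}"

definition hausdorff_dist :: "'a::metric_space set \<Rightarrow> 'a set \<Rightarrow> real" where
  "hausdorff_dist A B = (if A = {} \<or> B = {} then 0
     else max (SUP a\<in>A. infdist a B) (SUP b\<in>B. infdist b A))"

lemma hausdorff_dist_commute: "hausdorff_dist A B = hausdorff_dist B A"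
  by (simp add: hausdorff_dist_def max.commute)

lemma bdd_above_infdist:
  assumes "compact A" shows "bdd_above ((\<lambda>a. infdist a B) ` A)"
  using assms
  by (intro bounded_imp_bdd_above compact_imp_bounded compact_continuous_image continuous_intros)

lemma infdist_le_hausdorff_dist:
  assumes "compact A" "a \<in> A" shows "infdist a B \<le> hausdorff_dist A B"
proof (cases "B = {}")
  case True
  then show ?thesis by (simp add: hausdorff_dist_def infdist_def)
next
  case False
  have "infdist a B \<le> (SUP a\<in>A. infdist a B)"
    using cSUP_upper[OF assms(2) bdd_above_infdist[OF assms(1)]] .
  then show ?thesis using False assms(2) by (auto simp: hausdorff_dist_def)
qed

lemma hausdorff_dist_leI:
  assumes "A \<noteq> {}" "B \<noteq> {}"
    and "\<And>a. a \<in> A \<Longrightarrow> infdist a B \<le> e" and "\<And>b. b \<in> B \<Longrightarrow> infdist b A \<le> e"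
  shows "hausdorff_dist A B \<le> e"
  unfolding hausdorff_dist_def using assms by (auto intro!: cSUP_least)

lemma infdist_triangle_hausdorff:
  assumes "compact B" "B \<noteq> {}"
  shows "infdist a C \<le> infdist a B + hausdorff_dist B C"
proof -
  obtain b where b: "b \<in> B" "infdist a B = dist a b"
  proof -
    obtain b where b: "b \<in> B" "\<And>y. y \<in> B \<Longrightarrow> dist a b \<le> dist a y"
      using continuous_attains_inf[OF assms, of "dist a"]
        continuous_on_dist[OF continuous_on_const continuous_on_id, of B a] by (auto simp: id_def)
    have "infdist a B = dist a b"
    proof (rule antisym)
      show "infdist a B \<le> dist a b" by (rule infdist_le[OF b(1)])
      show "dist a b \<le> infdist a B"
        using assms(2) b(2) by (auto simp: infdist_def intro!: cINF_greatest)
    qed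
    with b(1) that show thesis by blast
  qed
  have "infdist a C \<le> infdist b C + dist a b"
    by (rule infdist_triangle)
  then show ?thesis
    using infdist_le_hausdorff_dist[OF assms(1) b(1), of C] b(2) by simp
qed

lemma simple_loops_compact: "\<gamma> \<in> simple_loops \<Longrightarrow> compact \<gamma>"
  by (auto simp: simple_loops_def dest: homeomorphic_compactness)

lemma simple_loops_nonempty: "\<gamma> \<in> simple_loops \<Longrightarrow> \<gamma> \<noteq> {}"
  by (auto simp: simple_loops_def)

interpretation simple_loops: Metric_space simple_loops hausdorff_dist
proof
  fix A B :: "rsphere set"
  show "0 \<le> hausdorff_dist A B"
  proof (cases "A = {} \<or> B = {}")
    case True
    then show ?thesis by (simp add: hausdorff_dist_def)
  next
    case False
    then obtain a where a: "a \<in> A" by blast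
    have "bdd_above ((\<lambda>a. infdist a B) ` A)"
    proof -
      obtain b where b: "b \<in> B" using False by blast
      have "infdist x B \<le> 2" for x :: rsphere
      proof -
        have "norm (stereo y) = 1" for y
        proof (cases y)
          case (Fin z)
          have p: "1 + (cmod z)\<^sup>2 > 0" by (simp add: add_pos_nonneg)
          have "(2 * cmod z / (1 + (cmod z)\<^sup>2))\<^sup>2 + (((cmod z)\<^sup>2 - 1) / ((cmod z)\<^sup>2 + 1))\<^sup>2
              = ((2 * cmod z)\<^sup>2 + ((cmod z)\<^sup>2 - 1)\<^sup>2) / (1 + (cmod z)\<^sup>2)\<^sup>2"
            by (simp add: power_divide add_divide_distrib add.commute)
          also have "(2 * cmod z)\<^sup>2 + ((cmod z)\<^sup>2 - 1)\<^sup>2 = (1 + (cmod z)\<^sup>2)\<^sup>2"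
            by (simp add: power2_eq_square algebra_simps)
          finally show ?thesis
            using Fin p by (simp add: norm_Pair power_divide)
        qed (simp add: norm_Pair)
        then have "dist x b \<le> 2"
          unfolding dist_rsphere_def using norm_triangle_ineq4[of "stereo x" "stereo b"]
          by (simp add: dist_norm)
        then show ?thesis using infdist_le2[OF b] by blast
      qed
      then show ?thesis by (auto simp: bdd_above_def)
    qed
    from cSUP_upper[OF a this] infdist_nonneg[of a B]
    show ?thesis using False by (auto simp: hausdorff_dist_def)
  qed
  show "hausdorff_dist A B = hausdorff_dist B A"
    by (rule hausdorff_dist_commute)
next
  fix A B assume A: "A \<in> simple_loops" and B: "B \<in> simple_loops"
  note c = simple_loops_compact[OF A] simple_loops_compact[OF B]
  note n = simple_loops_nonempty[OF A] simple_loops_nonempty[OF B]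
  show "hausdorff_dist A B = 0 \<longleftrightarrow> A = B"
  proof
    assume h: "hausdorff_dist A B = 0"
    have "a \<in> B" if "a \<in> A" for a
      using infdist_le_hausdorff_dist[OF c(1) that, of B] h infdist_nonneg[of a B]
        in_closed_iff_infdist_zero[OF compact_imp_closed[OF c(2)] n(2)] by simp
    moreover have "b \<in> A" if "b \<in> B" for b
      using infdist_le_hausdorff_dist[OF c(2) that, of A] h infdist_nonneg[of b A]
        in_closed_iff_infdist_zero[OF compact_imp_closed[OF c(1)] n(1)]
      by (simp add: hausdorff_dist_commute)
    ultimately show "A = B" by blast
  next
    assume "A = B"
    then show "hausdorff_dist A B = 0"
      using n by (simp add: hausdorff_dist_def)
  qed
  fix C assume C: "C \<in> simple_loops"
  show "hausdorff_dist A C \<le> hausdorff_dist A B + hausdorff_dist B C"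
  proof (rule hausdorff_dist_leI[OF n(1) simple_loops_nonempty[OF C]])
    fix a assume "a \<in> A"
    then show "infdist a C \<le> hausdorff_dist A B + hausdorff_dist B C"
      using infdist_triangle_hausdorff[OF c(2) n(2), of a C]
        infdist_le_hausdorff_dist[OF c(1), of a B] by simp
  next
    fix x assume "x \<in> C"
    then show "infdist x A \<le> hausdorff_dist A B + hausdorff_dist B C"
      using infdist_triangle_hausdorff[OF c(2) n(2), of x A]
        infdist_le_hausdorff_dist[OF simple_loops_compact[OF C], of x B]
      by (simp add: hausdorff_dist_commute)
  qed
qed

definition loop_borel :: "rsphere set measure" where
  "loop_borel = sigma simple_loops {U. openin simple_loops.mtopology U}"

definition locally_finite_loop_measure :: "rsphere set measure \<Rightarrow> bool" where
  "locally_finite_loop_measure \<mu> \<longleftrightarrow>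
    (\<forall>\<gamma>\<in>simple_loops. \<exists>U. openin simple_loops.mtopology U \<and> \<gamma> \<in> U \<and> emeasure \<mu> U < \<infinity>)"

section \<open>The Brownian loop measure\<close>

definition heat_kernel :: "real \<Rightarrow> complex \<Rightarrow> complex \<Rightarrow> real" where
  "heat_kernel s x y = 1 / (2 * pi * s) * exp (- (cmod (x - y))\<^sup>2 / (2 * s))"

text \<open>For \<open>s < u\<^sub>1 < \<dots> < u\<^sub>n < t\<close>, \<open>bridge_weight z t s x [(u\<^sub>1, A\<^sub>1), \<dots>, (u\<^sub>n, A\<^sub>n)]\<close> is the density at \<open>z\<close>
  at time \<open>t\<close> of planar Brownian motion started from \<open>x\<close> at time \<open>s\<close> and required to be in
  \<open>A\<^sub>i\<close> at each time \<open>u\<^sub>i\<close>.\<close>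

fun bridge_weight ::
  "complex \<Rightarrow> real \<Rightarrow> real \<Rightarrow> complex \<Rightarrow> (real \<times> complex set) list \<Rightarrow> ennreal" where
  "bridge_weight z t s x [] = ennreal (heat_kernel (t - s) x z)"
| "bridge_weight z t s x ((u, A) # xs) =
    (\<integral>\<^sup>+ y. indicator A y * ennreal (heat_kernel (u - s) x y) * bridge_weight z t u y xs \<partial>lborel)"

text \<open>A loop of duration \<open>t\<close> is a continuous \<open>t\<close>-periodic function on the real line, so that
  changing the root is a translation of time.\<close>

definition rooted_loops :: "(real \<times> (real \<Rightarrow> complex)) set" where
  "rooted_loops = {(t, \<omega>). 0 < t \<and> continuous_on UNIV \<omega> \<and> (\<forall>s. \<omega> (s + t) = \<omega> s)}"

definition bridge_space :: "complex \<Rightarrow> real \<Rightarrow> (real \<Rightarrow> complex) measure" where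
  "bridge_space z t =
    restrict_space (\<Pi>\<^sub>M s\<in>UNIV. borel) {\<omega>. (t, \<omega>) \<in> rooted_loops \<and> \<omega> 0 = z}"

text \<open>The law of the planar Brownian bridge from \<open>z\<close> to \<open>z\<close> of duration \<open>t\<close>, specified by its
  finite-dimensional distributions.\<close>

definition brownian_bridge_law :: "complex \<Rightarrow> real \<Rightarrow> (real \<Rightarrow> complex) measure \<Rightarrow> bool" where
  "brownian_bridge_law z t P \<longleftrightarrow> prob_space P \<and> sets P = sets (bridge_space z t) \<and>
    (\<forall>xs. sorted_wrt (<) (map fst xs) \<and> (\<forall>(u, A)\<in>set xs. 0 < u \<and> u < t \<and> A \<in> sets borel) \<longrightarrow>
      emeasure P {\<omega>\<in>space P. \<forall>(u, A)\<in>set xs. \<omega> u \<in> A} =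
        bridge_weight z t 0 z xs / ennreal (heat_kernel t z z))"

text \<open>Below, \<open>Pbr z t\<close> stands for the law of the Brownian bridge from \<open>z\<close> to \<open>z\<close> of duration \<open>t\<close>.\<close>

definition rooted_loop_measure ::
  "(complex \<Rightarrow> real \<Rightarrow> (real \<Rightarrow> complex) measure) \<Rightarrow> (real \<times> (real \<Rightarrow> complex)) measure" where
  "rooted_loop_measure Pbr =
    (let R = restrict_space (borel \<Otimes>\<^sub>M (\<Pi>\<^sub>M s\<in>UNIV. borel)) rooted_loops in
     measure_of (space R) (sets R)
       (\<lambda>A. \<integral>\<^sup>+ z. \<integral>\<^sup>+ t. indicator {0<..} t * ennreal (1 / t * (1 / (2 * pi * t)))
              * emeasure (Pbr z t) {\<omega>\<in>space (Pbr z t). (t, \<omega>) \<in> A} \<partial>lborel \<partial>lborel))"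

definition unroot :: "real \<times> (real \<Rightarrow> complex) \<Rightarrow> (real \<times> (real \<Rightarrow> complex)) set" where
  "unroot l = {(fst l, \<lambda>s. snd l (s + u)) | u. True}"

text \<open>The image of the rooted measure under \<open>unroot\<close>, on the quotient \<open>\<sigma>\<close>-algebra.\<close>

definition brownian_loop_measure ::
  "(complex \<Rightarrow> real \<Rightarrow> (real \<Rightarrow> complex) measure) \<Rightarrow> (real \<times> (real \<Rightarrow> complex)) set measure" where
  "brownian_loop_measure Pbr =
    (let R = rooted_loop_measure Pbr in
     distr R (sigma (unroot ` rooted_loops)
                    {E. E \<subseteq> unroot ` rooted_loops \<and> unroot -` E \<inter> space R \<in> sets R}) unroot)"

definition loop_trace :: "(real \<times> (real \<Rightarrow> complex)) set \<Rightarrow> complex set" where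
  "loop_trace L = (\<Union>(t, \<omega>)\<in>L. range \<omega>)"

definition brownian_loop_mass ::
  "(complex \<Rightarrow> real \<Rightarrow> (real \<Rightarrow> complex) measure) \<Rightarrow> complex set \<Rightarrow> rsphere set \<Rightarrow> rsphere set \<Rightarrow> ennreal" where
  "brownian_loop_mass Pbr D V1 V2 =
    emeasure (brownian_loop_measure Pbr)
      {L\<in>space (brownian_loop_measure Pbr). loop_trace L \<subseteq> D \<and>
         Fin ` loop_trace L \<inter> V1 \<noteq> {} \<and> Fin ` loop_trace L \<inter> V2 \<noteq> {}}"

definition Lambda_star ::
  "(complex \<Rightarrow> real \<Rightarrow> (real \<Rightarrow> complex) measure) \<Rightarrow> rsphere set \<Rightarrow> rsphere set \<Rightarrow> real" where
  "Lambda_star Pbr V1 V2 =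
    Lim at_top (\<lambda>R. enn2real (brownian_loop_mass Pbr (ball 0 R) V1 V2) - ln (ln R))"

section \<open>Loop measures in domains\<close>

text \<open>A set is polar if every nonzero finite Borel measure with compact support in it has infinite
  logarithmic energy. Truncating the kernel at \<open>0\<close> does not affect finiteness of the energy of a
  compactly supported measure; the point at infinity is polar and can be left out.\<close>

definition log_kernel :: "complex \<Rightarrow> complex \<Rightarrow> ennreal" where
  "log_kernel z w = (if z = w then \<infinity> else ennreal (max 0 (- ln (cmod (z - w)))))"

definition polar :: "rsphere set \<Rightarrow> bool" where
  "polar V \<longleftrightarrow>
    (\<forall>\<nu> :: complex measure. \<forall>K. sets \<nu> = sets borel \<and> finite_measure \<nu> \<and> emeasure \<nu> UNIV \<noteq> 0 \<and>
       compact K \<and> Fin ` K \<subseteq> V \<and> emeasure \<nu> (- K) = 0 \<longrightarrow>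
       (\<integral>\<^sup>+ z. \<integral>\<^sup>+ w. log_kernel z w \<partial>\<nu> \<partial>\<nu>) = \<infinity>)"

text \<open>If the complement of \<open>D\<close> is polar (in particular for the whole sphere), \<open>\<Lambda>\<^sup>*(\<gamma>, - D)\<close> is not
  defined, and the loop measure in \<open>D\<close> is the plain restriction of \<open>\<mu>\<close>.\<close>

definition loop_measure_in ::
  "(complex \<Rightarrow> real \<Rightarrow> (real \<Rightarrow> complex) measure) \<Rightarrow> real \<Rightarrow> rsphere set measure \<Rightarrow>
    rsphere set \<Rightarrow> rsphere set measure" where
  "loop_measure_in Pbr c \<mu> D =
    density (restrict_space \<mu> {\<gamma>. \<gamma> \<subseteq> D})
      (\<lambda>\<gamma>. if polar (- D) then 1 else ennreal (exp (c / 2 * Lambda_star Pbr \<gamma> (- D))))"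

definition central_charge :: "real \<Rightarrow> real" where
  "central_charge \<kappa> = (6 - \<kappa>) * (3 * \<kappa> - 8) / (2 * \<kappa>)"

text \<open>The \<open>SLE\<^sub>\<kappa>\<close> loop measure, with an arbitrary multiplicative normalization: the nontrivial locally
  finite measure on simple loops, unique up to a positive scalar, for which the loop measures in
  domains obtained by restriction covariance are conformally invariant.\<close>

definition SLE_loop_measure ::
  "(complex \<Rightarrow> real \<Rightarrow> (real \<Rightarrow> complex) measure) \<Rightarrow> real \<Rightarrow> rsphere set measure \<Rightarrow> bool" where
  "SLE_loop_measure Pbr \<kappa> \<mu> \<longleftrightarrow>
    sets \<mu> = sets loop_borel \<and> emeasure \<mu> (space \<mu>) \<noteq> 0 \<and> locally_finite_loop_measure \<mu> \<and>
    (\<forall>D1 D2 \<psi>. rsphere_domain D1 \<and> rsphere_domain D2 \<and> conformal_map D1 D2 \<psi> \<longrightarrow>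
      distr (loop_measure_in Pbr (central_charge \<kappa>) \<mu> D1)
            (restrict_space loop_borel {\<gamma>. \<gamma> \<subseteq> D2}) (\<lambda>\<gamma>. \<psi> ` \<gamma>)
        = loop_measure_in Pbr (central_charge \<kappa>) \<mu> D2)"

section \<open>Measures on pairs of loops\<close>

definition two_loop_measure ::
  "(complex \<Rightarrow> real \<Rightarrow> (real \<Rightarrow> complex) measure) \<Rightarrow> real \<Rightarrow> rsphere set measure \<Rightarrow>
    (rsphere set \<times> rsphere set) measure" where
  "two_loop_measure Pbr c \<mu> =
    density (\<mu> \<Otimes>\<^sub>M \<mu>)
      (\<lambda>(\<gamma>1, \<gamma>2). if \<gamma>1 \<inter> \<gamma>2 = {} then ennreal (exp (c / 2 * Lambda_star Pbr \<gamma>1 \<gamma>2)) else 0)"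

definition disjoint_loop_pair_measure :: "(rsphere set \<times> rsphere set) measure \<Rightarrow> bool" where
  "disjoint_loop_pair_measure \<nu> \<longleftrightarrow>
    sets \<nu> = sets (loop_borel \<Otimes>\<^sub>M loop_borel) \<and> (AE (\<gamma>1, \<gamma>2) in \<nu>. \<gamma>1 \<inter> \<gamma>2 = {})"

definition moebius_invariant :: "(rsphere set \<times> rsphere set) measure \<Rightarrow> bool" where
  "moebius_invariant \<nu> \<longleftrightarrow>
    (\<forall>\<phi>\<in>moebius_transformations.
      distr \<nu> (loop_borel \<Otimes>\<^sub>M loop_borel) (\<lambda>(\<gamma>1, \<gamma>2). (\<phi> ` \<gamma>1, \<phi> ` \<gamma>2)) = \<nu>)"

definition cascade_relation ::
  "(complex \<Rightarrow> real \<Rightarrow> (real \<Rightarrow> complex) measure) \<Rightarrow> real \<Rightarrow> rsphere set measure \<Rightarrow>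
    (rsphere set \<times> rsphere set) measure \<Rightarrow> bool" where
  "cascade_relation Pbr c \<mu> \<nu> \<longleftrightarrow>
    (\<forall>A\<in>sets (loop_borel \<Otimes>\<^sub>M loop_borel).
      emeasure \<nu> A =
        (\<integral>\<^sup>+ \<gamma>1. (\<Sum>\<^sub>\<infinity>D\<in>components (- \<gamma>1).
            emeasure (loop_measure_in Pbr c \<mu> D)
              {\<gamma>2\<in>space (loop_measure_in Pbr c \<mu> D). (\<gamma>1, \<gamma>2) \<in> A}) \<partial>\<mu>))"

end

theory Submission
  imports Defs "HOL-Real_Asymp.Real_Asymp"
begin

text \<open>
  A Brownian loop is connected, so if it meets \<open>\<gamma>2 \<subseteq> D\<close>, where \<open>D\<close> is a component of the complement of
  \<open>\<gamma>1\<close>, then it leaves \<open>D\<close> iff it meets \<open>\<gamma>1\<close>. Hence \<open>\<Lambda>\<^sup>*(\<gamma>2, - D) = \<Lambda>\<^sup>*(\<gamma>1, \<gamma>2)\<close>, and as every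
  \<open>\<gamma>2\<close> disjoint from \<open>\<gamma>1\<close> lies in exactly one component, Tonelli's theorem turns the density formula
  into the cascade relation. The latter determines the measure, which gives uniqueness; together with
  the conformal invariance of the loop measures in domains it also gives Moebius invariance, without
  appeal to the invariance (or even the existence) of the limit \<open>\<Lambda>\<^sup>*\<close>.

  What remains is to see that the weight is jointly measurable, that the loop measure is
  \<open>\<sigma>\<close>-finite, and that a simple loop is not polar, so that the restriction covariance density in a
  component really is the exponential of \<open>\<Lambda>\<^sup>*\<close>.
\<close>

section \<open>The topology of the Riemann sphere\<close>

text \<open>The form of \<open>Lambda_star\<close> shapes the proof: \<open>Lim\<close> is an
  unspecified value where no limit exists, \<open>enn2real\<close> turns an infinite mass into 0,
  and \<open>emeasure\<close> is 0 on a non-measurable set. Identities between values of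
  \<open>Lambda_star\<close> are therefore obtained from equality of the Brownian events at every
  radius, before any limit is taken. Measurability asks for more, because the limit runs over
  uncountably many radii. The masses increase with the radius and the increments of
  \<open>ln (ln n)\<close> tend to 0, so convergence along the reals and along the integers are
  equivalent, with the same limit; what remains is a sequential limit of measurable functions. The
  events themselves constrain a path at uncountably many times, and a pair of compact sets at
  uncountably many points. Continuity of paths reduces the former to rational times, and a countable
  family of separating open sets handles the latter.\<close>

lemma norm_stereo: "norm (stereo x) = 1"
proof (cases x)
  case (Fin z)
  have p: "1 + (cmod z)\<^sup>2 > 0" by (simp add: add_pos_nonneg)
  have "(2 * cmod z / (1 + (cmod z)\<^sup>2))\<^sup>2 + (((cmod z)\<^sup>2 - 1) / ((cmod z)\<^sup>2 + 1))\<^sup>2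
      = ((2 * cmod z)\<^sup>2 + ((cmod z)\<^sup>2 - 1)\<^sup>2) / (1 + (cmod z)\<^sup>2)\<^sup>2"
    by (simp add: power_divide add_divide_distrib add.commute)
  also have "(2 * cmod z)\<^sup>2 + ((cmod z)\<^sup>2 - 1)\<^sup>2 = (1 + (cmod z)\<^sup>2)\<^sup>2"
    by (simp add: power2_eq_square algebra_simps)
  finally show ?thesis
    using Fin p by (simp add: norm_Pair power_divide)
qed (simp add: norm_Pair)

text \<open>Inverse stereographic projection from the north pole. \<open>Infty\<close> is no
  exception: there the first coordinate vanishes, so both sides are 0.\<close>

lemma affine_part_stereo: "affine_part x = fst (stereo x) /\<^sub>R (1 - snd (stereo x))"
proof (cases x)
  case (Fin z)
  have p: "1 + (cmod z)\<^sup>2 > 0" by (simp add: add_pos_nonneg)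
  have "1 - ((cmod z)\<^sup>2 - 1) / ((cmod z)\<^sup>2 + 1) = 2 / (1 + (cmod z)\<^sup>2)"
    using p by (simp add: field_simps)
  moreover have "2 / (1 + (cmod z)\<^sup>2) \<noteq> 0" using p by simp
  moreover have "z = (r *\<^sub>R z) /\<^sub>R r" if "r \<noteq> 0" for r
    using that by simp
  ultimately show ?thesis unfolding Fin by (simp only: stereo.simps affine_part.simps fst_conv snd_conv)
qed simp

lemma range_stereo: "range stereo = sphere 0 1"
proof
  show "range stereo \<subseteq> sphere 0 1" by (auto simp: norm_stereo)
  show "sphere 0 1 \<subseteq> range stereo"
  proof
    fix p :: "complex \<times> real" assume "p \<in> sphere 0 1"
    then obtain x h where p: "p = (x, h)" and n: "(cmod x)\<^sup>2 + h\<^sup>2 = 1"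
      by (cases p) (auto simp: norm_Pair)
    show "p \<in> range stereo"
    proof (cases "h = 1")
      case True
      then have "p = stereo Infty" using p n by simp
      then show ?thesis by blast
    next
      case False
      have "h\<^sup>2 \<le> 1" using n by (metis le_add_same_cancel2 zero_le_power2)
      then have h: "h < 1" using False by (simp add: abs_le_square_iff [of h 1, simplified, symmetric])
      define z where "z = x /\<^sub>R (1 - h)"
      have "(cmod z)\<^sup>2 = (1 - h\<^sup>2) / (1 - h)\<^sup>2"
        using n h by (simp add: z_def power_mult_distrib field_simps)
      also have "\<dots> = (1 + h) / (1 - h)"
      proof -
        have "1 - h\<^sup>2 = (1 + h) * (1 - h)" by (simp add: power2_eq_square algebra_simps)
        then show ?thesis using h by (simp add: power2_eq_square)
      qed
      finally have z: "(cmod z)\<^sup>2 = (1 + h) / (1 - h)" .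
      have e: "1 + (cmod z)\<^sup>2 = 2 / (1 - h)" "(cmod z)\<^sup>2 + 1 = 2 / (1 - h)" "(cmod z)\<^sup>2 - 1 = 2 * h / (1 - h)"
        unfolding z using h by (simp_all add: field_simps)
      have "stereo (Fin z) = ((1 - h) *\<^sub>R z, h)"
        unfolding stereo.simps e using h by simp
      then have "stereo (Fin z) = p"
        using h by (simp add: p z_def)
      then show ?thesis by (metis rangeI)
    qed
  qed
qed

lemma continuous_on_stereo [continuous_intros]: "continuous_on S stereo"
  unfolding continuous_on_iff by (metis dist_rsphere_def)

lemma continuous_on_Fin: "continuous_on S Fin"
proof -
  have "continuous_on S (\<lambda>z. stereo (Fin z))"
    unfolding stereo.simps
    by (intro continuous_intros) (auto simp: add_nonneg_eq_0_iff add.commute)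
  then show ?thesis
    by (simp add: continuous_on_iff dist_rsphere_def)
qed

lemma continuous_on_affine_part: "Infty \<notin> S \<Longrightarrow> continuous_on S affine_part"
proof -
  assume S: "Infty \<notin> S"
  have "snd (stereo x) \<noteq> 1" if "x \<in> S" for x
    using S that stereo_Fin_snd_neq by (cases x) auto
  then have "continuous_on S (\<lambda>x. fst (stereo x) /\<^sub>R (1 - snd (stereo x)))"
    by (intro continuous_intros) force
  then show ?thesis by (simp add: affine_part_stereo[abs_def])
qed

text \<open>The metric of \<open>rsphere\<close> is pulled back along \<open>stereo\<close>, which
  is therefore an isometry onto the unit sphere. Compactness, connectedness and local connectedness
  are imported from the Euclidean sphere this way.\<close>

lemma homeomorphic_rsphere_sphere: "(UNIV :: rsphere set) homeomorphic sphere (0 :: complex \<times> real) 1"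
proof -
  have "continuous_on (sphere 0 1) (inv stereo)"
    unfolding range_stereo[symmetric] continuous_on_iff
    by (auto simp: inj_stereo dist_rsphere_def)
  then have "homeomorphism UNIV (sphere 0 1) stereo (inv stereo)"
    unfolding homeomorphism_def range_stereo[symmetric] 
    using continuous_on_stereo by (auto simp: inj_stereo image_image)
  then show ?thesis unfolding homeomorphic_def by blast
qed

lemma compact_UNIV_rsphere: "compact (UNIV :: rsphere set)"
  using homeomorphic_compactness[OF homeomorphic_rsphere_sphere] by simp

lemma connected_UNIV_rsphere: "connected (UNIV :: rsphere set)"
  using homeomorphic_connectedness[OF homeomorphic_rsphere_sphere]
    connected_sphere[of "0 :: complex \<times> real" 1] by simp

lemma locally_connected_UNIV_rsphere: "locally connected (UNIV :: rsphere set)"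
  using homeomorphic_locally[OF homeomorphic_rsphere_sphere, of connected connected]
    homeomorphic_connectedness locally_connected_sphere by blast

lemma open_components_rsphere:
  fixes S :: "rsphere set"
  assumes "open S" "D \<in> components S" shows "open D"
proof -
  have "locally connected S"
    using locally_open_subset[OF locally_connected_UNIV_rsphere] assms(1) by simp
  then show ?thesis
    using openin_components_locally_connected assms openin_open_eq by blast
qed

text \<open>Components of an open set are open by local connectedness. A frontier point of
  \<open>D\<close> outside \<open>S\<close> would lie in some component \<open>E\<close>, which then
  meets \<open>D\<close> and so equals it, although an open set contains none of its frontier
  points.\<close>

lemma frontier_component_subset_rsphere:
  fixes S :: "rsphere set"
  assumes "closed S" "D \<in> components (- S)" shows "frontier D \<subseteq> S"
proof
  fix x assume x: "x \<in> frontier D"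
  show "x \<in> S"
  proof (rule ccontr)
    assume "x \<notin> S"
    then obtain E where E: "E \<in> components (- S)" "x \<in> E"
      using Union_components[of "- S"] by blast
    then have "open E" "open D"
      using open_components_rsphere assms by (meson open_Compl)+
    then have "x \<notin> D" using x by (simp add: frontier_def interior_open)
    have "E \<inter> D \<noteq> {}"
      using x \<open>open E\<close> E(2) by (auto simp: frontier_def closure_iff_nhds_not_empty)
    then have "E = D" using components_nonoverlap[OF E(1) assms(2)] by blast
    then show False using E \<open>x \<notin> D\<close> by blast
  qed
qed

section \<open>Second countability of the sphere and its consequences\<close>

lemma countable_basis_rsphere:
  obtains B :: "rsphere set set" where "countable B" "topological_basis B"
proof -
  obtain C :: "(complex \<times> real) set set" where C: "countable C" "topological_basis C"
    using ex_countable_basis by blast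
  have "topological_basis ((\<lambda>U. stereo -` U) ` C)"
  proof (rule topological_basisI)
    show "open U" if "U \<in> (\<lambda>U. stereo -` U) ` C" for U
      using that topological_basis_open[OF C(2)] open_vimage continuous_on_stereo by blast
    fix O' :: "rsphere set" and x assume "open O'" "x \<in> O'"
    then obtain e where e: "e > 0" "ball x e \<subseteq> O'" by (meson openE)
    obtain V where V: "V \<in> C" "stereo x \<in> V" "V \<subseteq> ball (stereo x) e"
      using topological_basisE[OF C(2) open_ball, of "stereo x" "stereo x" e] e(1) by auto
    have "stereo -` V \<subseteq> O'"
      using V(3) e(2) by (force simp: dist_rsphere_def)
    then show "\<exists>B'\<in>(\<lambda>U. stereo -` U) ` C. x \<in> B' \<and> B' \<subseteq> O'"
      using V by auto
  qed
  then show thesis using that C(1) by blast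
qed

text \<open>Each member contains a nonempty basis set, and disjointness makes the choice of one
  injective.\<close>

lemma countable_disjoint_open_family:
  assumes "\<And>D. D \<in> F \<Longrightarrow> open (D :: rsphere set) \<and> D \<noteq> {}" "disjoint F"
  shows "countable F"
proof -
  obtain B :: "rsphere set set" where B: "countable B" "topological_basis B"
    using countable_basis_rsphere by blast
  have "\<exists>b\<in>B. b \<subseteq> D \<and> b \<noteq> {}" if D: "D \<in> F" for D
  proof -
    obtain x where "x \<in> D" using assms(1)[OF D] by blast
    then show ?thesis
      using topological_basisE[OF B(2), of D x] assms(1)[OF D] by (metis empty_iff)
  qed
  then obtain f where f: "\<And>D. D \<in> F \<Longrightarrow> f D \<in> B \<and> f D \<subseteq> D \<and> f D \<noteq> {}" by metis
  have "inj_on f F"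
  proof (rule inj_onI)
    fix D E assume "D \<in> F" "E \<in> F" "f D = f E"
    then have "D \<inter> E \<noteq> {}" using f by blast
    then show "D = E" using assms(2) \<open>D \<in> F\<close> \<open>E \<in> F\<close> by (auto simp: disjoint_def)
  qed
  moreover have "countable (f ` F)"
    using f B(1) by (metis countable_subset image_subsetI)
  ultimately show ?thesis by (metis countable_image_inj_on)
qed

text \<open>Countability is what allows the sum over components in the cascade relation to be
  exchanged with an integral.\<close>

lemma countable_components_rsphere:
  assumes "open (S :: rsphere set)" shows "countable (components S)"
proof (rule countable_disjoint_open_family)
  show "open D \<and> D \<noteq> {}" if "D \<in> components S" for D
    using that open_components_rsphere[OF assms] in_components_nonempty by blast
  show "disjoint (components S)" using components_nonoverlap by (fastforce simp: disjoint_def)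
qed

text \<open>Finite unions of basis sets do. Disjointness of two compact sets thereby becomes a
  countable condition: some \<open>V\<close> in the family contains the first and misses the
  second.\<close>

lemma countable_compact_neighbourhoods_rsphere:
  obtains C :: "rsphere set set" where "countable C" "\<And>U. U \<in> C \<Longrightarrow> open U"
    "\<And>K U. compact K \<Longrightarrow> open U \<Longrightarrow> K \<subseteq> U \<Longrightarrow> \<exists>V\<in>C. K \<subseteq> V \<and> V \<subseteq> U"
proof -
  obtain B :: "rsphere set set" where B: "countable B" "topological_basis B"
    using countable_basis_rsphere by blast
  show thesis
  proof (rule that[of "Union ` {F. finite F \<and> F \<subseteq> B}"])
    show "countable (Union ` {F. finite F \<and> F \<subseteq> B})"
      using countable_Collect_finite_subset[OF B(1)] by blast
    show "open U" if "U \<in> Union ` {F. finite F \<and> F \<subseteq> B}" for U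
      using that topological_basis_open[OF B(2)] by blast
    fix K U :: "rsphere set" assume K: "compact K" and U: "open U" "K \<subseteq> U"
    define G where "G = {b\<in>B. b \<subseteq> U}"
    have "K \<subseteq> \<Union>G"
    proof
      fix x assume "x \<in> K"
      then show "x \<in> \<Union>G"
        using topological_basisE[OF B(2) U(1), of x] U(2) unfolding G_def by blast
    qed
    moreover have "open b" if "b \<in> G" for b
      using that topological_basis_open[OF B(2)] by (auto simp: G_def)
    ultimately obtain F where "F \<subseteq> G" "finite F" "K \<subseteq> \<Union>F"
      using compactE[OF K] by metis
    then show "\<exists>V\<in>Union ` {F. finite F \<and> F \<subseteq> B}. K \<subseteq> V \<and> V \<subseteq> U"
      by (intro bexI[of _ "\<Union>F"]) (auto simp: G_def)
  qed
qed

section \<open>The Borel structure of the space of simple loops\<close>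

lemma space_loop_borel: "space loop_borel = simple_loops"
  unfolding loop_borel_def
  by (rule space_measure_of) (use openin_subset in force)

lemma sets_loop_borel:
  "sets loop_borel = sigma_sets simple_loops {U. openin simple_loops.mtopology U}"
  unfolding loop_borel_def
  by (rule sets_measure_of) (use openin_subset in force)

lemma openin_sets_loop_borel: "openin simple_loops.mtopology U \<Longrightarrow> U \<in> sets loop_borel"
  unfolding sets_loop_borel by blast

lemma infdist_lessD:
  assumes "infdist a B < e" "B \<noteq> {}" shows "\<exists>b\<in>B. dist a b < e"
  using assms cINF_less_iff[of B "dist a" e] by (auto simp: infdist_def intro: bdd_belowI2[of _ 0])

lemma hausdorff_dist_lessD:
  assumes "\<gamma> \<in> simple_loops" "\<gamma>' \<in> simple_loops" "hausdorff_dist \<gamma> \<gamma>' < e"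
  shows "\<forall>a\<in>\<gamma>. \<exists>b\<in>\<gamma>'. dist a b < e" "\<forall>b\<in>\<gamma>'. \<exists>a\<in>\<gamma>. dist b a < e"
proof -
  show "\<forall>a\<in>\<gamma>. \<exists>b\<in>\<gamma>'. dist a b < e"
    using infdist_le_hausdorff_dist[OF simple_loops_compact[OF assms(1)], of _ \<gamma>'] assms(3)
      infdist_lessD[OF _ simple_loops_nonempty[OF assms(2)]] by fastforce
  show "\<forall>b\<in>\<gamma>'. \<exists>a\<in>\<gamma>. dist b a < e"
    using infdist_le_hausdorff_dist[OF simple_loops_compact[OF assms(2)], of _ \<gamma>] assms(3)
      infdist_lessD[OF _ simple_loops_nonempty[OF assms(1)]]
      hausdorff_dist_commute[of \<gamma> \<gamma>'] by fastforce
qed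

lemma hausdorff_dist_le_near:
  assumes "\<gamma> \<in> simple_loops" "\<gamma>' \<in> simple_loops"
    and "\<And>a. a \<in> \<gamma> \<Longrightarrow> \<exists>b\<in>\<gamma>'. dist a b \<le> e" "\<And>b. b \<in> \<gamma>' \<Longrightarrow> \<exists>a\<in>\<gamma>. dist b a \<le> e"
  shows "hausdorff_dist \<gamma> \<gamma>' \<le> e"
  using assms infdist_le2
  by (intro hausdorff_dist_leI simple_loops_nonempty) blast+

lemma sets_loops_subset_open:
  assumes "open U" shows "{\<gamma>\<in>simple_loops. \<gamma> \<subseteq> U} \<in> sets loop_borel"
proof (rule openin_sets_loop_borel, unfold simple_loops.openin_mtopology, intro conjI allI impI)
  fix \<gamma> assume \<gamma>: "\<gamma> \<in> {\<gamma>\<in>simple_loops. \<gamma> \<subseteq> U}"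
  then obtain e where e: "e > 0" "(\<Union>x\<in>\<gamma>. ball x e) \<subseteq> U"
    using compact_subset_open_imp_ball_epsilon_subset[OF simple_loops_compact assms] by blast
  have "simple_loops.mball \<gamma> e \<subseteq> {\<gamma>\<in>simple_loops. \<gamma> \<subseteq> U}"
  proof
    fix \<gamma>' assume "\<gamma>' \<in> simple_loops.mball \<gamma> e"
    then have *: "\<gamma>' \<in> simple_loops" "hausdorff_dist \<gamma> \<gamma>' < e" by auto
    have "b \<in> U" if "b \<in> \<gamma>'" for b
      using hausdorff_dist_lessD(2)[OF _ *] that \<gamma> e(2) by (force simp: dist_commute)
    then show "\<gamma>' \<in> {\<gamma>\<in>simple_loops. \<gamma> \<subseteq> U}" using * by blast
  qed
  then show "\<exists>r>0. simple_loops.mball \<gamma> r \<subseteq> {\<gamma>\<in>simple_loops. \<gamma> \<subseteq> U}" using e(1) by blast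
qed auto

lemma sets_loops_meet_open:
  assumes "open U" shows "{\<gamma>\<in>simple_loops. \<gamma> \<inter> U \<noteq> {}} \<in> sets loop_borel"
proof (rule openin_sets_loop_borel, unfold simple_loops.openin_mtopology, intro conjI allI impI)
  fix \<gamma> assume \<gamma>: "\<gamma> \<in> {\<gamma>\<in>simple_loops. \<gamma> \<inter> U \<noteq> {}}"
  then obtain x where x: "x \<in> \<gamma>" "x \<in> U" by blast
  obtain e where e: "e > 0" "ball x e \<subseteq> U" using assms x(2) by (meson openE)
  have "simple_loops.mball \<gamma> e \<subseteq> {\<gamma>\<in>simple_loops. \<gamma> \<inter> U \<noteq> {}}"
  proof
    fix \<gamma>' assume "\<gamma>' \<in> simple_loops.mball \<gamma> e"
    then have *: "\<gamma>' \<in> simple_loops" "hausdorff_dist \<gamma> \<gamma>' < e" by auto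
    then obtain b where "b \<in> \<gamma>'" "dist x b < e"
      using hausdorff_dist_lessD(1)[OF _ *] \<gamma> x(1) by auto
    then show "\<gamma>' \<in> {\<gamma>\<in>simple_loops. \<gamma> \<inter> U \<noteq> {}}" using * e(2) by auto
  qed
  then show "\<exists>r>0. simple_loops.mball \<gamma> r \<subseteq> {\<gamma>\<in>simple_loops. \<gamma> \<inter> U \<noteq> {}}" using e(1) by blast
qed auto

lemma sets_loops_disjoint:
  "{p\<in>space (loop_borel \<Otimes>\<^sub>M loop_borel). fst p \<inter> snd p = {}} \<in> sets (loop_borel \<Otimes>\<^sub>M loop_borel)"
proof -
  obtain C :: "rsphere set set" where C: "countable C" "\<And>U. U \<in> C \<Longrightarrow> open U"
    "\<And>K U. compact K \<Longrightarrow> open U \<Longrightarrow> K \<subseteq> U \<Longrightarrow> \<exists>V\<in>C. K \<subseteq> V \<and> V \<subseteq> U"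
    using countable_compact_neighbourhoods_rsphere by blast
  let ?S = "\<lambda>V. {\<gamma>\<in>simple_loops. \<gamma> \<subseteq> V} \<times> (space loop_borel - {\<gamma>\<in>simple_loops. \<gamma> \<inter> V \<noteq> {}})"
  have "{p\<in>space (loop_borel \<Otimes>\<^sub>M loop_borel). fst p \<inter> snd p = {}} = (\<Union>V\<in>C. ?S V)"
  proof (intro set_eqI iffI)
    fix p assume "p \<in> {p\<in>space (loop_borel \<Otimes>\<^sub>M loop_borel). fst p \<inter> snd p = {}}"
    then have p: "fst p \<in> simple_loops" "snd p \<in> simple_loops" "fst p \<inter> snd p = {}"
      by (auto simp: space_pair_measure space_loop_borel)
    have "open (- snd p)" using p(2) simple_loops_compact compact_imp_closed by blast
    then obtain V where "V \<in> C" "fst p \<subseteq> V" "V \<subseteq> - snd p"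
      using C(3)[OF simple_loops_compact[OF p(1)], of "- snd p"] p(3) by blast
    then show "p \<in> (\<Union>V\<in>C. ?S V)"
      using p by (cases p) (auto simp: space_loop_borel)
  next
    fix p assume "p \<in> (\<Union>V\<in>C. ?S V)"
    then obtain V where "V \<in> C" "p \<in> ?S V" by blast
    then show "p \<in> {p\<in>space (loop_borel \<Otimes>\<^sub>M loop_borel). fst p \<inter> snd p = {}}"
      by (cases p) (simp add: space_pair_measure space_loop_borel, blast)
  qed
  also have "\<dots> \<in> sets (loop_borel \<Otimes>\<^sub>M loop_borel)"
    using C(2) by (intro sets.countable_UN'' C(1) pair_measureI sets_loops_subset_open sets.compl_sets
        sets_loops_meet_open)
  finally show ?thesis .
qed

lemma simple_loops_image:
  assumes "\<gamma> \<in> simple_loops" "continuous_on UNIV \<phi>" "inj \<phi>"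
  shows "\<phi> ` \<gamma> \<in> simple_loops"
proof -
  have "\<gamma> homeomorphic \<phi> ` \<gamma>"
    using homeomorphic_compact[OF simple_loops_compact[OF assms(1)]] assms(2,3)
    by (meson continuous_on_subset inj_on_subset subset_UNIV)
  then show ?thesis
    using assms(1) unfolding simple_loops_def by (metis homeomorphic_sym homeomorphic_trans mem_Collect_eq)
qed

text \<open>On the compact sphere \<phi> is uniformly continuous, which makes the induced map on
  loops continuous for the Hausdorff distance.\<close>

lemma measurable_loop_image:
  assumes "continuous_on UNIV \<phi>" "inj \<phi>"
  shows "(\<lambda>\<gamma>. \<phi> ` \<gamma>) \<in> loop_borel \<rightarrow>\<^sub>M loop_borel"
proof (rule measurable_sigma_sets[OF sets_loop_borel])
  show "{U. openin simple_loops.mtopology U} \<subseteq> Pow simple_loops"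
    using openin_subset by force
  show "(\<lambda>\<gamma>. \<phi> ` \<gamma>) \<in> space loop_borel \<rightarrow> simple_loops"
    using simple_loops_image[OF _ assms] by (auto simp: space_loop_borel)
  fix U assume "U \<in> {U. openin simple_loops.mtopology U}"
  then have U: "openin simple_loops.mtopology U" by simp
  have uc: "uniformly_continuous_on UNIV \<phi>"
    using compact_uniformly_continuous assms(1) compact_UNIV_rsphere by blast
  have "openin simple_loops.mtopology ((\<lambda>\<gamma>. \<phi> ` \<gamma>) -` U \<inter> simple_loops)"
    unfolding simple_loops.openin_mtopology
  proof (intro conjI allI impI)
    fix \<gamma> assume "\<gamma> \<in> (\<lambda>\<gamma>. \<phi> ` \<gamma>) -` U \<inter> simple_loops"
    then have \<gamma>: "\<phi> ` \<gamma> \<in> U" "\<gamma> \<in> simple_loops" by auto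
    then obtain r where r: "r > 0" "simple_loops.mball (\<phi> ` \<gamma>) r \<subseteq> U"
      using U unfolding simple_loops.openin_mtopology by blast
    \<comment> \<open>Half the radius, because \<open>hausdorff_dist_le_near\<close> yields only a
      weak inequality while \<open>mball\<close> is open.\<close>
    obtain e where e: "e > 0" "\<And>x y. dist x y < e \<Longrightarrow> dist (\<phi> x) (\<phi> y) < r / 2"
      using uc r(1) unfolding uniformly_continuous_on_def by (metis UNIV_I half_gt_zero dist_commute)
    have "\<phi> ` \<gamma>' \<in> U" if \<gamma>': "\<gamma>' \<in> simple_loops" "hausdorff_dist \<gamma> \<gamma>' < e" for \<gamma>'
    proof -
      have "hausdorff_dist (\<phi> ` \<gamma>) (\<phi> ` \<gamma>') \<le> r / 2"
      proof (rule hausdorff_dist_le_near)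
        show "\<exists>b\<in>\<phi> ` \<gamma>'. dist a b \<le> r / 2" if "a \<in> \<phi> ` \<gamma>" for a
          using that hausdorff_dist_lessD(1)[OF \<gamma>(2) \<gamma>'] e(2) by (force intro: less_imp_le)
        show "\<exists>b\<in>\<phi> ` \<gamma>. dist a b \<le> r / 2" if "a \<in> \<phi> ` \<gamma>'" for a
          using that hausdorff_dist_lessD(2)[OF \<gamma>(2) \<gamma>'] e(2) by (force intro: less_imp_le)
      qed (use \<gamma>(2) \<gamma>'(1) simple_loops_image[OF _ assms] in auto)
      then have "\<phi> ` \<gamma>' \<in> simple_loops.mball (\<phi> ` \<gamma>) r"
        using r(1) simple_loops_image[OF _ assms] \<gamma>(2) \<gamma>'(1) by simp
      then show ?thesis using r(2) by blast
    qed
    then show "\<exists>r>0. simple_loops.mball \<gamma> r \<subseteq> (\<lambda>\<gamma>. \<phi> ` \<gamma>) -` U \<inter> simple_loops"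
      using e(1) by (intro exI[of _ e]) auto
  qed auto
  then show "(\<lambda>\<gamma>. \<phi> ` \<gamma>) -` U \<inter> space loop_borel \<in> sets loop_borel"
    by (simp add: space_loop_borel openin_sets_loop_borel)
qed

text \<open>The sets \<open>W F\<close> are those of the Vietoris topology: loops covered by
  \<open>F\<close> that meet every member of \<open>F\<close>. If the members of \<open>F\<close>
  have diameter at most \<open>r / 2\<close>, two loops in \<open>W F\<close> have Hausdorff
  distance at most \<open>r / 2\<close>. A network is enough for extracting countable subcovers, so
  openness of its members is not at issue.\<close>

lemma countable_network_simple_loops:
  obtains N :: "rsphere set set set" where "countable N"
    "\<And>U \<gamma>. openin simple_loops.mtopology U \<Longrightarrow> \<gamma> \<in> U \<Longrightarrow> \<exists>W\<in>N. \<gamma> \<in> W \<and> W \<subseteq> U"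
proof -
  obtain B :: "rsphere set set" where B: "countable B" "topological_basis B"
    using countable_basis_rsphere by blast
  define W where "W F = {\<gamma>\<in>simple_loops. \<gamma> \<subseteq> \<Union>F \<and> (\<forall>b\<in>F. \<gamma> \<inter> b \<noteq> {})}" for F
  show thesis
  proof (rule that[of "W ` {F. finite F \<and> F \<subseteq> B}"])
    show "countable (W ` {F. finite F \<and> F \<subseteq> B})"
      using countable_Collect_finite_subset[OF B(1)] by blast
    fix U \<gamma> assume U: "openin simple_loops.mtopology U" "\<gamma> \<in> U"
    then have \<gamma>: "\<gamma> \<in> simple_loops" using openin_subset by force
    obtain r where r: "r > 0" "simple_loops.mball \<gamma> r \<subseteq> U"
      using U unfolding simple_loops.openin_mtopology by blast
    define G where "G = {b\<in>B. b \<inter> \<gamma> \<noteq> {} \<and> (\<forall>x\<in>b. \<forall>y\<in>b. dist x y \<le> r / 2)}"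
    have "x \<in> \<Union>G" if x: "x \<in> \<gamma>" for x
    proof -
      obtain b where b: "b \<in> B" "x \<in> b" "b \<subseteq> ball x (r / 4)"
        using topological_basisE[OF B(2) open_ball, of x x "r / 4"] r(1) by auto
      have "dist y z \<le> r / 2" if "y \<in> b" "z \<in> b" for y z
      proof -
        have "dist x y < r / 4" "dist x z < r / 4" using b(3) that by auto
        then show ?thesis using dist_triangle[of y z x] by (simp add: dist_commute)
      qed
      then show ?thesis using b x by (auto simp: G_def)
    qed
    moreover have "open b" if "b \<in> G" for b
      using that topological_basis_open[OF B(2)] by (auto simp: G_def)
    ultimately obtain F where F: "F \<subseteq> G" "finite F" "\<gamma> \<subseteq> \<Union>F"
      using compactE[OF simple_loops_compact[OF \<gamma>]] by (metis subsetI)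
    have "W F \<subseteq> U"
    proof
      fix \<gamma>' assume "\<gamma>' \<in> W F"
      then have \<gamma>': "\<gamma>' \<in> simple_loops" "\<gamma>' \<subseteq> \<Union>F" "\<forall>b\<in>F. \<gamma>' \<inter> b \<noteq> {}" by (auto simp: W_def)
      have "hausdorff_dist \<gamma> \<gamma>' \<le> r / 2"
      proof (rule hausdorff_dist_le_near[OF \<gamma> \<gamma>'(1)])
        fix a assume "a \<in> \<gamma>"
        then obtain b where b: "b \<in> F" "a \<in> b" using F(3) by blast
        then obtain a' where "a' \<in> \<gamma>'" "a' \<in> b" using \<gamma>'(3) by blast
        then show "\<exists>b\<in>\<gamma>'. dist a b \<le> r / 2" using b F(1) by (auto simp: G_def)
      next
        fix a assume "a \<in> \<gamma>'"
        then obtain b where b: "b \<in> F" "a \<in> b" using \<gamma>'(2) by blast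
        then obtain a' where "a' \<in> \<gamma>" "a' \<in> b" using F(1) unfolding G_def by blast
        then show "\<exists>b\<in>\<gamma>. dist a b \<le> r / 2" using b F(1) by (auto simp: G_def)
      qed
      then show "\<gamma>' \<in> U" using r \<gamma> \<gamma>'(1) by auto
    qed
    moreover have "\<gamma> \<in> W F" using \<gamma> F by (auto simp: W_def G_def)
    ultimately show "\<exists>W\<in>W ` {F. finite F \<and> F \<subseteq> B}. \<gamma> \<in> W \<and> W \<subseteq> U"
      using F by (intro bexI[of _ "W F"]) (auto simp: G_def)
  qed
qed

text \<open>A Lindelof argument: for every network set that fits into an open set of finite measure
  one such open set is chosen. Countably many are chosen, and local finiteness makes them cover all
  loops.\<close>

lemma sigma_finite_locally_finite_loop_measure:
  assumes "sets \<mu> = sets loop_borel" "locally_finite_loop_measure \<mu>"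
  shows "sigma_finite_measure \<mu>"
proof
  obtain N :: "rsphere set set set" where N: "countable N"
    "\<And>U \<gamma>. openin simple_loops.mtopology U \<Longrightarrow> \<gamma> \<in> U \<Longrightarrow> \<exists>W\<in>N. \<gamma> \<in> W \<and> W \<subseteq> U"
    using countable_network_simple_loops by blast
  let ?P = "\<lambda>W U. openin simple_loops.mtopology U \<and> W \<subseteq> U \<and> emeasure \<mu> U < \<infinity>"
  define N' where "N' = {W\<in>N. \<exists>U. ?P W U}"
  define f where "f W = (SOME U. ?P W U)" for W
  have f: "?P W (f W)" if "W \<in> N'" for W
    using that someI_ex[of "?P W"] by (auto simp: N'_def f_def)
  have sp: "space \<mu> = simple_loops"
    using sets_eq_imp_space_eq[OF assms(1)] by (simp add: space_loop_borel)
  have "simple_loops \<subseteq> \<Union> (f ` N')"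
  proof
    fix \<gamma> assume "\<gamma> \<in> simple_loops"
    then obtain U where U: "openin simple_loops.mtopology U" "\<gamma> \<in> U" "emeasure \<mu> U < \<infinity>"
      using assms(2) unfolding locally_finite_loop_measure_def by blast
    then obtain W where "W \<in> N" "\<gamma> \<in> W" "W \<subseteq> U" using N(2) by blast
    then have "W \<in> N'" using U by (auto simp: N'_def)
    then show "\<gamma> \<in> \<Union> (f ` N')" using f \<open>\<gamma> \<in> W\<close> by blast
  qed
  moreover have "f W \<subseteq> simple_loops" if "W \<in> N'" for W
    using f[OF that] openin_subset by force
  ultimately have "\<Union> (f ` N') = space \<mu>" using sp by blast
  moreover have "countable (f ` N')" using N(1) by (auto simp: N'_def)
  moreover have "f ` N' \<subseteq> sets \<mu>" using f assms(1) openin_sets_loop_borel by blast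
  ultimately show "\<exists>A. countable A \<and> A \<subseteq> sets \<mu> \<and> \<Union>A = space \<mu> \<and> (\<forall>a\<in>A. emeasure \<mu> a \<noteq> \<infinity>)"
    using f by (intro exI[of _ "f ` N'"]) (auto simp: less_top)
qed

section \<open>Joint measurability of the normalized Brownian loop measure\<close>

text \<open>The measurable space underlying \<open>rooted_loop_measure\<close>, named separately
  because it does not depend on \<open>Pbr\<close>.\<close>

definition rooted_loop_space :: "(real \<times> (real \<Rightarrow> complex)) measure" where
  "rooted_loop_space = restrict_space (borel \<Otimes>\<^sub>M (\<Pi>\<^sub>M s\<in>UNIV. borel)) rooted_loops"

lemma space_rooted_loop_space: "space rooted_loop_space = rooted_loops"
  by (simp add: rooted_loop_space_def space_restrict_space space_pair_measure space_PiM)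

lemma measurable_rooted_loop_duration: "fst \<in> borel_measurable rooted_loop_space"
  unfolding rooted_loop_space_def by (intro measurable_restrict_space1) simp

lemma measurable_rooted_loop_eval: "(\<lambda>l. snd l s) \<in> borel_measurable rooted_loop_space"
  unfolding rooted_loop_space_def
  by (intro measurable_restrict_space1 measurable_compose[OF measurable_snd measurable_component_singleton]) simp

lemma sets_rooted_loop_measure: "sets (rooted_loop_measure Pbr) = sets rooted_loop_space"
  by (simp add: rooted_loop_measure_def Let_def rooted_loop_space_def[symmetric])

lemma space_rooted_loop_measure: "space (rooted_loop_measure Pbr) = rooted_loops"
  using sets_eq_imp_space_eq[OF sets_rooted_loop_measure] by (simp add: space_rooted_loop_space)

section \<open>Measurable events for Brownian loops\<close>

lemma closure_Rats_real: "closure (\<rat> :: real set) = UNIV"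
proof -
  have "\<exists>y\<in>\<rat>. dist y x < e" if e: "e > 0" for x e :: real
  proof -
    obtain y where "y \<in> \<rat>" "x < y" "y < x + e" using Rats_dense_in_real[of x "x + e"] e by auto
    then show ?thesis by (intro bexI[of _ y]) (auto simp: dist_real_def)
  qed
  then show ?thesis by (auto simp: closure_approachable)
qed

lemma compact_range_rooted_loop:
  assumes "l \<in> rooted_loops" shows "compact (range (snd l))"
proof -
  obtain t \<omega> where l: "l = (t, \<omega>)" by (cases l)
  then have t: "0 < t" "continuous_on UNIV \<omega>" "\<And>s. \<omega> (s + t) = \<omega> s"
    using assms by (auto simp: rooted_loops_def)
  interpret periodic_fun_simple \<omega> t by standard (rule t(3))
  have "range \<omega> = \<omega> ` {0..t}"
  proof -
    have "\<omega> s \<in> \<omega> ` {0..t}" for s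
    proof
      have "of_int \<lfloor>s / t\<rfloor> \<le> s / t" "s / t \<le> of_int \<lfloor>s / t\<rfloor> + 1" by linarith+
      then have "of_int \<lfloor>s / t\<rfloor> * t \<le> s" "s \<le> (of_int \<lfloor>s / t\<rfloor> + 1) * t"
        using t(1) by (metis pos_le_divide_eq, metis pos_divide_le_eq)
      then show "s - of_int \<lfloor>s / t\<rfloor> * t \<in> {0..t}"
        by (simp add: algebra_simps)
      show "\<omega> s = \<omega> (s - of_int \<lfloor>s / t\<rfloor> * t)" by (simp add: minus_of_int)
    qed
    then show ?thesis by blast
  qed
  then show ?thesis
    using compact_continuous_image[OF continuous_on_subset[OF t(2)], of "{0..t}"] l by simp
qed

lemma connected_range_rooted_loop:
  assumes "l \<in> rooted_loops" shows "connected (range (snd l))"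
  using assms connected_continuous_image[of UNIV "snd l"] by (auto simp: rooted_loops_def)

text \<open>The product \<sigma>-algebra sees only countably many times at once. A continuous path
  that is in \<open>C\<close> at all rational times stays in \<open>C\<close>, since
  \<open>C\<close> is closed.\<close>

lemma sets_rooted_loops_range_closed:
  assumes "closed C" shows "{l\<in>rooted_loops. range (snd l) \<subseteq> C} \<in> sets rooted_loop_space"
proof -
  have "{l\<in>rooted_loops. range (snd l) \<subseteq> C} = {l\<in>space rooted_loop_space. \<forall>q\<in>\<rat>. snd l q \<in> C}"
  proof -
    have "range (snd l) \<subseteq> C" if "l \<in> rooted_loops" "\<forall>q\<in>\<rat>. snd l q \<in> C" for l
    proof -
      have "continuous_on UNIV (snd l)" using that(1) by (auto simp: rooted_loops_def)
      then show ?thesis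
        using image_closure_subset[of \<rat> "snd l" C] that(2) assms
        by (simp add: closure_Rats_real image_subset_iff)
    qed
    then show ?thesis by (auto simp: space_rooted_loop_space)
  qed
  also have "\<dots> = {l\<in>space rooted_loop_space. \<forall>q. snd l (of_rat q) \<in> C}"
    by (auto simp: Rats_def)
  also have "\<dots> \<in> sets rooted_loop_space"
    by (intro sets.sets_Collect_countable_All measurable_sets_Collect[OF measurable_rooted_loop_eval])
      (use assms in auto)
  finally show ?thesis .
qed

text \<open>Rational times do not decide containment in an open ball, as the path could touch the
  boundary in between. The range is compact, so its largest modulus is attained and leaves a gap
  below \<open>r\<close>; this gives a countable union of closed conditions.\<close>

lemma sets_rooted_loops_range_ball:
  "{l\<in>rooted_loops. range (snd l) \<subseteq> ball 0 r} \<in> sets rooted_loop_space"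
proof -
  have "{l\<in>rooted_loops. range (snd l) \<subseteq> ball 0 r}
      = (\<Union>n. {l\<in>rooted_loops. range (snd l) \<subseteq> cball 0 (r - 1 / Suc n)})"
  proof (intro set_eqI iffI)
    fix l :: "real \<times> (real \<Rightarrow> complex)"
    assume "l \<in> {l\<in>rooted_loops. range (snd l) \<subseteq> ball 0 r}"
    then have l: "l \<in> rooted_loops" "range (snd l) \<subseteq> ball 0 r" by auto
    obtain x where x: "x \<in> range (snd l)" "\<And>y. y \<in> range (snd l) \<Longrightarrow> norm y \<le> norm x"
      using continuous_attains_sup[OF compact_range_rooted_loop[OF l(1)] _ continuous_on_norm_id] by blast
    then have "0 < r - norm x" using l(2) by auto
    then obtain n where "inverse (of_nat (Suc n)) < r - norm x"
      using reals_Archimedean by blast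
    then have "range (snd l) \<subseteq> cball 0 (r - 1 / Suc n)"
      using x(2) by (fastforce simp: inverse_eq_divide simp del: of_nat_Suc)
    then show "l \<in> (\<Union>n. {l\<in>rooted_loops. range (snd l) \<subseteq> cball 0 (r - 1 / Suc n)})" using l(1) by blast
  next
    fix l :: "real \<times> (real \<Rightarrow> complex)"
    assume "l \<in> (\<Union>n. {l\<in>rooted_loops. range (snd l) \<subseteq> cball 0 (r - 1 / Suc n)})"
    then obtain n where n: "l \<in> rooted_loops" "range (snd l) \<subseteq> cball 0 (r - 1 / Suc n)" by blast
    have "0 < 1 / Suc n" by simp
    have "cball 0 (r - 1 / Suc n) \<subseteq> ball (0::complex) r" 
    proof
      fix x :: complex assume "x \<in> cball 0 (r - 1 / Suc n)"
      then have "cmod x \<le> r - 1 / Suc n" by (simp only: mem_cball_0)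
      then have "cmod x < r" using \<open>0 < 1 / Suc n\<close> by linarith
      then show "x \<in> ball 0 r" by simp
    qed
    then show "l \<in> {l\<in>rooted_loops. range (snd l) \<subseteq> ball 0 r}" using n by blast
  qed
  also have "\<dots> \<in> sets rooted_loop_space"
    by (intro sets.countable_UN) (auto intro: sets_rooted_loops_range_closed)
  finally show ?thesis .
qed

text \<open>Both the loop and the Brownian trace are compact, so some \<open>V\<close> of the
  countable family contains the loop and misses the trace. Each \<open>V\<close> contributes a
  rectangle, whose path factor is confinement to the closed preimage of \<open>- V\<close> under
  \<open>Fin\<close>.\<close>

lemma sets_loop_avoids_rooted_loop:
  "{x\<in>space (loop_borel \<Otimes>\<^sub>M rooted_loop_space). Fin ` range (snd (snd x)) \<inter> fst x = {}}
     \<in> sets (loop_borel \<Otimes>\<^sub>M rooted_loop_space)"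
proof -
  obtain C :: "rsphere set set" where C: "countable C" "\<And>U. U \<in> C \<Longrightarrow> open U"
    "\<And>K U. compact K \<Longrightarrow> open U \<Longrightarrow> K \<subseteq> U \<Longrightarrow> \<exists>V\<in>C. K \<subseteq> V \<and> V \<subseteq> U"
    using countable_compact_neighbourhoods_rsphere by blast
  let ?S = "\<lambda>V. {\<gamma>\<in>simple_loops. \<gamma> \<subseteq> V} \<times> {l\<in>rooted_loops. range (snd l) \<subseteq> Fin -` (- V)}"
  have "{x\<in>space (loop_borel \<Otimes>\<^sub>M rooted_loop_space). Fin ` range (snd (snd x)) \<inter> fst x = {}} = (\<Union>V\<in>C. ?S V)"
  proof (intro set_eqI iffI)
    fix x assume x: "x \<in> {x\<in>space (loop_borel \<Otimes>\<^sub>M rooted_loop_space). Fin ` range (snd (snd x)) \<inter> fst x = {}}"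
    obtain \<gamma> l where xe: "x = (\<gamma>, l)" by (cases x)
    have p: "\<gamma> \<in> simple_loops" "l \<in> rooted_loops" "Fin ` range (snd l) \<inter> \<gamma> = {}"
      using x by (simp_all add: xe space_pair_measure space_loop_borel space_rooted_loop_space)
    have "compact (Fin ` range (snd l))"
      by (rule compact_continuous_image[OF continuous_on_Fin compact_range_rooted_loop[OF p(2)]])
    then have "open (- Fin ` range (snd l))" using compact_imp_closed by blast
    then obtain V where "V \<in> C" "\<gamma> \<subseteq> V" "V \<subseteq> - Fin ` range (snd l)"
      using C(3)[OF simple_loops_compact[OF p(1)], of "- Fin ` range (snd l)"] p(3) by blast
    then show "x \<in> (\<Union>V\<in>C. ?S V)"
      unfolding xe using p by blast
  next
    fix x assume "x \<in> (\<Union>V\<in>C. ?S V)"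
    then obtain V where "V \<in> C" "x \<in> ?S V" by blast
    then show "x \<in> {x\<in>space (loop_borel \<Otimes>\<^sub>M rooted_loop_space). Fin ` range (snd (snd x)) \<inter> fst x = {}}"
      by (cases x) (simp add: space_pair_measure space_loop_borel space_rooted_loop_space, blast)
  qed
  also have "\<dots> \<in> sets (loop_borel \<Otimes>\<^sub>M rooted_loop_space)"
  proof (intro sets.countable_UN'' C(1) pair_measureI sets_loops_subset_open sets_rooted_loops_range_closed)
    show "closed (Fin -` (- V))" if "V \<in> C" for V
      using C(2)[OF that] continuous_on_Fin by (intro closed_vimage) auto
  qed (use C(2) in auto)
  finally show ?thesis .
qed

text \<open>The preimage under \<open>unroot\<close> of the event in
  \<open>brownian_loop_mass\<close> for the ball of radius \<open>r\<close>. On rooted loops it can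
  be studied jointly with the pair \<open>p\<close>, away from the quotient
  \<sigma>-algebra.\<close>

definition rooted_hitting_loops :: "real \<Rightarrow> rsphere set \<times> rsphere set \<Rightarrow> (real \<times> (real \<Rightarrow> complex)) set" where
  "rooted_hitting_loops r p = {l\<in>rooted_loops. range (snd l) \<subseteq> ball 0 r \<and>
     Fin ` range (snd l) \<inter> fst p \<noteq> {} \<and> Fin ` range (snd l) \<inter> snd p \<noteq> {}}"

lemma sets_rooted_hitting_loops_joint:
  "{x\<in>space ((loop_borel \<Otimes>\<^sub>M loop_borel) \<Otimes>\<^sub>M rooted_loop_space). snd x \<in> rooted_hitting_loops r (fst x)}
     \<in> sets ((loop_borel \<Otimes>\<^sub>M loop_borel) \<Otimes>\<^sub>M rooted_loop_space)" (is "_ \<in> sets ?M")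
proof -
  have a: "Measurable.pred (loop_borel \<Otimes>\<^sub>M rooted_loop_space) (\<lambda>x. Fin ` range (snd (snd x)) \<inter> fst x = {})"
    using sets_loop_avoids_rooted_loop by (simp add: pred_def)
  have 1: "Measurable.pred ?M (\<lambda>x. Fin ` range (snd (snd x)) \<inter> fst (fst x) = {})"
    using measurable_compose[of "\<lambda>x. (fst (fst x), snd x)" ?M, OF _ a] by simp
  have 2: "Measurable.pred ?M (\<lambda>x. Fin ` range (snd (snd x)) \<inter> snd (fst x) = {})"
    using measurable_compose[of "\<lambda>x. (snd (fst x), snd x)" ?M, OF _ a] by simp
  have "Measurable.pred rooted_loop_space (\<lambda>l. range (snd l) \<subseteq> ball 0 r)"
    using sets_rooted_loops_range_ball by (simp add: pred_def space_rooted_loop_space)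
  then have 3: "Measurable.pred ?M (\<lambda>x. range (snd (snd x)) \<subseteq> ball 0 r)"
    using measurable_compose[OF measurable_snd] by blast
  have "{x\<in>space ?M. snd x \<in> rooted_hitting_loops r (fst x)} = {x\<in>space ?M. range (snd (snd x)) \<subseteq> ball 0 r \<and>
    \<not> Fin ` range (snd (snd x)) \<inter> fst (fst x) = {} \<and> \<not> Fin ` range (snd (snd x)) \<inter> snd (fst x) = {}}"
    by (auto simp: rooted_hitting_loops_def space_pair_measure space_rooted_loop_space)
  also have "\<dots> \<in> sets ?M"
    unfolding pred_def[symmetric] by (intro pred_intros_logic 1 2 3)
  finally show ?thesis .
qed

lemma sets_rooted_hitting_loops:
  assumes "p \<in> simple_loops \<times> simple_loops"
  shows "rooted_hitting_loops r p \<in> sets rooted_loop_space"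
proof -
  have "Pair p -` {x\<in>space ((loop_borel \<Otimes>\<^sub>M loop_borel) \<Otimes>\<^sub>M rooted_loop_space). snd x \<in> rooted_hitting_loops r (fst x)}
      = rooted_hitting_loops r p"
    using assms by (auto simp: space_pair_measure space_loop_borel space_rooted_loop_space rooted_hitting_loops_def)
  with sets_Pair1[OF sets_rooted_hitting_loops_joint[of r], of p] show ?thesis by (simp only:)
qed

lemma loop_trace_unroot: "loop_trace (unroot l) = range (snd l)"
proof -
  have "snd l s \<in> range (\<lambda>s. snd l (s + u))" for s u
    by (rule image_eqI[of _ _ "s - u"]) auto
  then show ?thesis by (auto simp: loop_trace_def unroot_def)
qed

text \<open>The trace does not depend on the root, so the event for unrooted loops and the one for
  rooted loops correspond exactly under \<open>unroot\<close>.\<close>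

lemma brownian_loop_mass_ball:
  assumes "\<gamma>1 \<in> simple_loops" "\<gamma>2 \<in> simple_loops"
  shows "brownian_loop_mass Pbr (ball 0 r) \<gamma>1 \<gamma>2
    = emeasure (rooted_loop_measure Pbr) (rooted_hitting_loops r (\<gamma>1, \<gamma>2))"
proof -
  let ?R = "rooted_loop_measure Pbr"
  let ?G = "{E. E \<subseteq> unroot ` rooted_loops \<and> unroot -` E \<inter> space ?R \<in> sets ?R}"
  let ?N = "sigma (unroot ` rooted_loops) ?G"
  let ?E = "{L\<in>unroot ` rooted_loops. loop_trace L \<subseteq> ball 0 r \<and>
         Fin ` loop_trace L \<inter> \<gamma>1 \<noteq> {} \<and> Fin ` loop_trace L \<inter> \<gamma>2 \<noteq> {}}"
  have G: "?G \<subseteq> Pow (unroot ` rooted_loops)" by blast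
  have u: "unroot \<in> ?R \<rightarrow>\<^sub>M ?N"
    by (rule measurable_measure_of[OF G]) (auto simp: space_rooted_loop_measure)
  have pre: "unroot -` ?E \<inter> space ?R = rooted_hitting_loops r (\<gamma>1, \<gamma>2)"
    unfolding space_rooted_loop_measure rooted_hitting_loops_def
    by (simp add: loop_trace_unroot set_eq_iff) blast
  \<comment> \<open>Measurability in the quotient is measurability of the preimage. Without this
    check \<open>emeasure\<close> could be 0 merely by convention.\<close>
  have "?E \<in> ?G"
    using pre sets_rooted_hitting_loops[of "(\<gamma>1, \<gamma>2)" r] assms by (simp add: sets_rooted_loop_measure)
  then have E: "?E \<in> sets ?N"
    unfolding sets_measure_of[OF G] by (rule sigma_sets.Basic)
  have "brownian_loop_mass Pbr (ball 0 r) \<gamma>1 \<gamma>2 = emeasure (distr ?R ?N unroot) ?E"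
    using G by (simp add: brownian_loop_mass_def brownian_loop_measure_def Let_def space_measure_of)
  also have "\<dots> = emeasure ?R (rooted_hitting_loops r (\<gamma>1, \<gamma>2))"
    by (simp only: emeasure_distr[OF u E] pre)
  finally show ?thesis .
qed

text \<open>Infinite mass comes from short durations, long durations and the translations of the
  root; the sets \<open>A n\<close> bound all three.\<close>

lemma sigma_finite_rooted_loop_measure:
  assumes bridge: "\<And>z t. 0 < t \<Longrightarrow> brownian_bridge_law z t (Pbr z t)"
  shows "sigma_finite_measure (rooted_loop_measure Pbr)"
proof
  define A where "A n = {l\<in>rooted_loops. fst l \<in> {1 / Suc n..Suc n} \<and> snd l 0 \<in> cball 0 (Suc n)}" for n :: nat
  have sA: "A n \<in> sets rooted_loop_space" for n
  proof -
    have "A n = {l\<in>space rooted_loop_space. fst l \<in> {1 / Suc n..Suc n} \<and> snd l 0 \<in> cball 0 (Suc n)}"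
      by (auto simp: A_def space_rooted_loop_space)
    also have "\<dots> \<in> sets rooted_loop_space"
      by (intro sets.sets_Collect_conj measurable_sets_Collect[OF measurable_rooted_loop_eval]
          measurable_sets_Collect[OF measurable_rooted_loop_duration]) auto
    finally show ?thesis .
  qed
  have fin: "emeasure (rooted_loop_measure Pbr) (A n) \<noteq> \<infinity>" for n
  proof -
    let ?f = "\<lambda>z t. indicator {0<..} t * ennreal (1 / t * (1 / (2 * pi * t)))
              * emeasure (Pbr z t) {\<omega>\<in>space (Pbr z t). (t, \<omega>) \<in> A n}"
    let ?C = "ennreal (Suc n * Suc n)"
    \<comment> \<open>A bridge path has \<open>\<omega> 0 = z\<close>, so the event is empty unless
      \<open>z\<close> is in the ball and \<open>t\<close> is in \<open>[1 / Suc n, Suc n]\<close>.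
      There \<open>1 / t\<close> and \<open>1 / (2 * pi * t)\<close> are each at most
      \<open>Suc n\<close>, and the probability is at most 1.\<close>
    have bound: "?f z t \<le> (?C * indicator (cball 0 (Suc n)) z) * indicator {0..Suc n} t" for z :: complex and t :: real
    proof (cases "0 < t \<and> {\<omega>\<in>space (Pbr z t). (t, \<omega>) \<in> A n} \<noteq> {}")
      case False
      then have "?f z t = 0" by (cases "0 < t") (auto simp del: Collect_empty_eq)
      then show ?thesis by (simp only: zero_le)
    next
      case True
      then obtain \<omega> where \<omega>: "\<omega> \<in> space (Pbr z t)" "(t, \<omega>) \<in> A n" and t: "0 < t" by blast
      have law: "brownian_bridge_law z t (Pbr z t)" using bridge t by blast
      then have "space (Pbr z t) = space (bridge_space z t)" 
        unfolding brownian_bridge_law_def using sets_eq_imp_space_eq by blast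
      then have "\<omega> 0 = z" using \<omega>(1) by (auto simp: bridge_space_def space_restrict_space)
      then have z: "z \<in> cball 0 (Suc n)" and t1: "1 / Suc n \<le> t" "t \<le> Suc n"
        using \<omega>(2) by (auto simp: A_def)
      interpret prob_space "Pbr z t" using law by (simp add: brownian_bridge_law_def)
      have it: "1 / t \<le> Suc n" using t t1(1) by (simp add: field_simps)
      have "1 / (2 * pi * t) \<le> 1 / t"
      proof (rule divide_left_mono)
        have "1 * t \<le> (2 * pi) * t" using t pi_ge_two by (intro mult_right_mono) auto
        then show "t \<le> 2 * pi * t" by simp
      qed (use t in auto)
      then have "1 / (2 * pi * t) \<le> Suc n" using it by linarith
      then have "1 / t * (1 / (2 * pi * t)) \<le> Suc n * Suc n"
        using it t unfolding of_nat_mult by (intro mult_mono) auto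
      then have "ennreal (1 / t * (1 / (2 * pi * t))) * emeasure (Pbr z t) {\<omega>\<in>space (Pbr z t). (t, \<omega>) \<in> A n} \<le> ?C * 1"
        by (intro mult_mono ennreal_leI measure_le_1) auto
      then show ?thesis using z t t1 by simp
    qed
    have "(\<integral>\<^sup>+ z. \<integral>\<^sup>+ t. ?f z t \<partial>lborel \<partial>lborel)
      \<le> (\<integral>\<^sup>+ z. \<integral>\<^sup>+ t. (?C * indicator (cball (0::complex) (Suc n)) z) * indicator {0..Suc n} t \<partial>lborel \<partial>lborel)"
      by (intro nn_integral_mono bound)
    also have "\<dots> = (\<integral>\<^sup>+ z. (?C * ennreal (Suc n)) * indicator (cball (0::complex) (Suc n)) z \<partial>lborel)"
      by (intro nn_integral_cong, subst nn_integral_cmult_indicator) (simp_all add: mult_ac del: of_nat_Suc)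
    also have "\<dots> = ?C * ennreal (Suc n) * emeasure lborel (cball (0::complex) (Suc n))"
      by (simp add: nn_integral_cmult_indicator)
    also have "\<dots> < \<infinity>"
      using emeasure_bounded_finite[OF bounded_cball, of "0::complex" "Suc n"]
      by (auto simp: ennreal_mult_eq_top_iff less_top[symmetric] simp del: of_nat_Suc)
    finally have *: "(\<integral>\<^sup>+ z. \<integral>\<^sup>+ t. ?f z t \<partial>lborel \<partial>lborel) < \<infinity>" .
    \<comment> \<open>\<open>measure_of\<close> gives the prescribed set function if that is a
      measure and the zero measure otherwise; the bound holds in either case.\<close>
    have "emeasure (rooted_loop_measure Pbr) (A n) \<le> (\<integral>\<^sup>+ z. \<integral>\<^sup>+ t. ?f z t \<partial>lborel \<partial>lborel)"
      by (simp add: rooted_loop_measure_def Let_def emeasure_measure_of_conv)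
    also note *
    finally show ?thesis by simp
  qed
  have "rooted_loops \<subseteq> (\<Union>n. A n)"
  proof
    fix l assume l: "l \<in> rooted_loops"
    then have t: "0 < fst l" by (auto simp: rooted_loops_def)
    obtain n where n: "1 / fst l \<le> real n" "fst l \<le> real n" "norm (snd l 0) \<le> real n"
      using real_arch_simple[of "max (1 / fst l) (max (fst l) (norm (snd l 0)))"] by auto
    have "1 \<le> real n * fst l" using n(1) t by (simp add: field_simps)
    also have "\<dots> \<le> real (Suc n) * fst l" using t by (intro mult_right_mono) auto
    finally have "1 / real (Suc n) \<le> fst l" by (simp add: field_simps)
    then have "l \<in> A n" using l n by (auto simp: A_def)
    then show "l \<in> (\<Union>n. A n)" by blast
  qed
  moreover have "A n \<subseteq> rooted_loops" for n by (auto simp: A_def)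
  ultimately have "(\<Union>n. A n) = space (rooted_loop_measure Pbr)" by (auto simp: space_rooted_loop_measure)
  then show "\<exists>B. countable B \<and> B \<subseteq> sets (rooted_loop_measure Pbr) \<and> \<Union>B = space (rooted_loop_measure Pbr)
      \<and> (\<forall>a\<in>B. emeasure (rooted_loop_measure Pbr) a \<noteq> \<infinity>)"
    using sA fin by (intro exI[of _ "range A"]) (auto simp: sets_rooted_loop_measure)
qed

text \<open>Between consecutive integers \<open>m\<close> is trapped by monotonicity, and
  \<open>ln (ln R)\<close> varies by an amount tending to 0, so the values at integers control those
  at all reals.\<close>

lemma tendsto_enn2real_minus_ln_ln_iff:
  fixes m :: "real \<Rightarrow> ennreal"
  assumes "mono m"
  shows "((\<lambda>R. enn2real (m R) - ln (ln R)) \<longlongrightarrow> l) at_top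
    \<longleftrightarrow> (\<lambda>n. enn2real (m (real n)) - ln (ln (real n))) \<longlonglongrightarrow> l" (is "(?f \<longlongrightarrow> l) at_top \<longleftrightarrow> ?g \<longlonglongrightarrow> l")
proof
  assume "(?f \<longlongrightarrow> l) at_top"
  then show "?g \<longlonglongrightarrow> l"
    by (rule filterlim_compose) (rule filterlim_real_sequentially)
next
  assume g: "?g \<longlonglongrightarrow> l"
  \<comment> \<open>Since \<open>enn2real\<close> sends infinity to 0, an infinite value of
    \<open>m\<close> would leave only \<open>- ln (ln k)\<close> for all large \<open>k\<close>,
    which diverges. Finiteness is what makes \<open>enn2real\<close> preserve the monotonicity of
    \<open>m\<close>.\<close>
  have fin: "m (real n) < \<infinity>" for n
  proof (rule ccontr)
    assume "\<not> m (real n) < \<infinity>"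
    then have "m (real k) = \<infinity>" if "k \<ge> n" for k
      using monoD[OF assms, of "real n" "real k"] that by (simp add: top_unique flip: less_top)
    then have "\<forall>\<^sub>F k in sequentially. ?g k = - ln (ln (real k))"
      by (intro eventually_sequentiallyI[of n]) simp
    then have "(\<lambda>k. - ln (ln (real k))) \<longlonglongrightarrow> l"
      by (rule Lim_transform_eventually[OF g])
    moreover have "filterlim (\<lambda>k. - ln (ln (real k))) at_infinity sequentially" by real_asymp
    ultimately show False
      using not_tendsto_and_filterlim_at_infinity by (metis sequentially_bot)
  qed
  have finR: "m R < \<infinity>" for R
    using fin[of "nat \<lceil>R\<rceil>"] monoD[OF assms, of R "real (nat \<lceil>R\<rceil>)"]
    by (meson le_less_trans real_nat_ceiling_ge)
  have mono: "enn2real (m x) \<le> enn2real (m y)" if "x \<le> y" for x y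
    using monoD[OF assms that] finR[of y] by (intro enn2real_mono) auto
  \<comment> \<open>After cancellation \<open>u n\<close> is \<open>m (n + 1) - ln (ln n)\<close>
    and \<open>v n\<close> is \<open>m n - ln (ln (n + 1))\<close>: the extreme values possible for
    \<open>R\<close> in \<open>[n, n + 1]\<close>. In the form given, their limits are
    immediate.\<close>
  define u where "u n = ?g (Suc n) + (ln (ln (real (Suc n))) - ln (ln (real n)))" for n
  define v where "v n = ?g n - (ln (ln (real (Suc n))) - ln (ln (real n)))" for n
  have d: "(\<lambda>n. ln (ln (real (Suc n))) - ln (ln (real n))) \<longlonglongrightarrow> 0" by real_asymp
  have fl: "filterlim (\<lambda>R::real. nat \<lfloor>R\<rfloor>) sequentially at_top"
    by (intro filterlim_compose[OF filterlim_nat_sequentially] filterlim_floor_sequentially)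
  have "u \<longlonglongrightarrow> l + 0" unfolding u_def by (intro tendsto_add d LIMSEQ_Suc[OF g])
  from filterlim_compose[OF this fl] have u: "((\<lambda>R::real. u (nat \<lfloor>R\<rfloor>)) \<longlongrightarrow> l) at_top" by simp
  have "v \<longlonglongrightarrow> l - 0" unfolding v_def by (intro tendsto_diff d g)
  from filterlim_compose[OF this fl] have v: "((\<lambda>R::real. v (nat \<lfloor>R\<rfloor>)) \<longlongrightarrow> l) at_top" by simp
  \<comment> \<open>From 3 on, the integer part exceeds \<open>exp 1\<close>, so the inner
    logarithms are positive and \<open>ln (ln R)\<close> is monotone.\<close>
  have b: "v (nat \<lfloor>R\<rfloor>) \<le> ?f R \<and> ?f R \<le> u (nat \<lfloor>R\<rfloor>)" if R: "R \<ge> 3" for R :: real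
  proof -
    define n where "n = nat \<lfloor>R\<rfloor>"
    have n: "real n \<le> R" "R \<le> real (Suc n)" "3 \<le> n" using R unfolding n_def by linarith+
    have "1 < ln (real n)"
    proof -
      have "exp 1 < real n" using exp_le n(3) e_less_272 by linarith
      then show ?thesis using ln_less_cancel_iff[of "exp 1" "real n"] n(3) by simp
    qed
    then have "ln (ln (real n)) \<le> ln (ln R)" "ln (ln R) \<le> ln (ln (real (Suc n)))"
      using n R by (auto intro!: ln_mono)
    moreover have "enn2real (m (real n)) \<le> enn2real (m R)" "enn2real (m R) \<le> enn2real (m (real (Suc n)))"
      using n mono by auto
    ultimately show ?thesis unfolding u_def v_def n_def[symmetric] by linarith
  qed
  show "(?f \<longlongrightarrow> l) at_top"
    by (rule tendsto_sandwich[OF _ _ v u]; rule eventually_mono[OF eventually_ge_at_top[of 3]]) (use b in auto)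
qed

text \<open>\<open>Lim\<close> and \<open>lim\<close> are both definite descriptions. The two
  convergence statements are equivalent for every candidate limit, so the descriptions coincide even
  where there is no limit.\<close>

lemma Lambda_star_eq_lim:
  assumes "\<gamma>1 \<in> simple_loops" "\<gamma>2 \<in> simple_loops"
  shows "Lambda_star Pbr \<gamma>1 \<gamma>2
    = lim (\<lambda>n. enn2real (emeasure (rooted_loop_measure Pbr) (rooted_hitting_loops (real n) (\<gamma>1, \<gamma>2))) - ln (ln (real n)))"
proof -
  have "mono (\<lambda>R. emeasure (rooted_loop_measure Pbr) (rooted_hitting_loops R (\<gamma>1, \<gamma>2)))"
  proof (intro monoI emeasure_mono)
    fix x y :: real assume "x \<le> y"
    then have "ball (0::complex) x \<subseteq> ball 0 y" by (rule subset_ball)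
    then show "rooted_hitting_loops x (\<gamma>1, \<gamma>2) \<subseteq> rooted_hitting_loops y (\<gamma>1, \<gamma>2)"
      unfolding rooted_hitting_loops_def by blast
    show "rooted_hitting_loops y (\<gamma>1, \<gamma>2) \<in> sets (rooted_loop_measure Pbr)"
      using assms sets_rooted_hitting_loops[of "(\<gamma>1, \<gamma>2)"] by (simp add: sets_rooted_loop_measure)
  qed
  from tendsto_enn2real_minus_ln_ln_iff[OF this] show ?thesis
    unfolding Lambda_star_def brownian_loop_mass_ball[OF assms] t2_space_class.Lim_def lim_def by simp
qed

text \<open>At a fixed radius the mass is the measure of a section of a jointly measurable set,
  hence measurable in the pair because the rooted measure is \<sigma>-finite. The \<open>lim\<close>
  of a sequence of Borel functions is Borel also where the sequence diverges.\<close>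

lemma measurable_Lambda_star:
  assumes "\<And>z t. 0 < t \<Longrightarrow> brownian_bridge_law z t (Pbr z t)"
  shows "(\<lambda>p. Lambda_star Pbr (fst p) (snd p)) \<in> borel_measurable (loop_borel \<Otimes>\<^sub>M loop_borel)"
proof -
  let ?R = "rooted_loop_measure Pbr"
  interpret sigma_finite_measure ?R by (rule sigma_finite_rooted_loop_measure[OF assms])
  have sp: "space (loop_borel \<Otimes>\<^sub>M loop_borel) = simple_loops \<times> simple_loops"
    by (simp add: space_pair_measure space_loop_borel)
  have [measurable]: "(\<lambda>p. emeasure ?R (rooted_hitting_loops r p)) \<in> borel_measurable (loop_borel \<Otimes>\<^sub>M loop_borel)" for r
  proof -
    let ?Q = "{x\<in>space ((loop_borel \<Otimes>\<^sub>M loop_borel) \<Otimes>\<^sub>M rooted_loop_space). snd x \<in> rooted_hitting_loops r (fst x)}"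
    have "?Q \<in> sets ((loop_borel \<Otimes>\<^sub>M loop_borel) \<Otimes>\<^sub>M ?R)"
      using sets_rooted_hitting_loops_joint[of r]
        sets_pair_measure_cong[OF refl sets_rooted_loop_measure] by metis
    then have "(\<lambda>p. emeasure ?R (Pair p -` ?Q)) \<in> borel_measurable (loop_borel \<Otimes>\<^sub>M loop_borel)"
      by (rule measurable_emeasure_Pair)
    moreover have "Pair p -` ?Q = rooted_hitting_loops r p" if "p \<in> space (loop_borel \<Otimes>\<^sub>M loop_borel)" for p
      using that by (auto simp: space_pair_measure[of "loop_borel \<Otimes>\<^sub>M loop_borel"] space_rooted_loop_space rooted_hitting_loops_def)
    ultimately show ?thesis by (simp cong: measurable_cong_simp)
  qed
  have "(\<lambda>p. lim (\<lambda>n. enn2real (emeasure ?R (rooted_hitting_loops (real n) p)) - ln (ln (real n))))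
      \<in> borel_measurable (loop_borel \<Otimes>\<^sub>M loop_borel)"
    by measurable
  moreover have "lim (\<lambda>n. enn2real (emeasure ?R (rooted_hitting_loops (real n) p)) - ln (ln (real n)))
      = Lambda_star Pbr (fst p) (snd p)" if "p \<in> space (loop_borel \<Otimes>\<^sub>M loop_borel)" for p
    using that Lambda_star_eq_lim[of "fst p" "snd p" Pbr] by (auto simp: sp)
  ultimately show ?thesis by (simp cong: measurable_cong_simp)
qed

section \<open>Simple loops are not polar\<close>

text \<open>Uniformity in \<open>x\<close> comes from translation invariance of Lebesgue measure.
  Each side of the singularity contributes at most 4, and the infinite value at \<open>y = x\<close>
  sits on a null set.\<close>

lemma nn_integral_log_singularity_finite:
  obtains C where "C < \<infinity>"
    "\<And>x. (\<integral>\<^sup>+ y. (if y = x then \<infinity> else ennreal (max 0 (- ln \<bar>x - y\<bar>))) \<partial>lborel) \<le> C"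
proof -
  \<comment> \<open>An integrable majorant of \<open>- ln u\<close> near 0: apply
    \<open>ln v \<le> v - 1\<close> to \<open>v = u powr (- 1 / 2)\<close>, for which
    \<open>- ln u = 2 * ln v\<close>.\<close>
  define \<psi> :: "real \<Rightarrow> ennreal" where "\<psi> u = ennreal (2 * u powr (- 1 / 2)) * indicator {0..1} u" for u
  have [measurable]: "\<psi> \<in> borel_measurable borel" unfolding \<psi>_def by measurable
  have "((\<lambda>u. u powr (- 1 / 2)) has_integral (1 powr (- 1 / 2 + 1) / (- 1 / 2 + 1))) {0..1::real}"
    by (rule has_integral_powr_from_0) auto
  then have "((\<lambda>u. 2 * u powr (- 1 / 2)) has_integral 4) {0..1::real}"
    using has_integral_mult_right[of "\<lambda>u. u powr (- 1 / 2)" 2 "{0..1::real}" "2::real"] by simp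
  then have \<psi>: "(\<integral>\<^sup>+ u. \<psi> u \<partial>lborel) = 4"
    unfolding \<psi>_def by (subst nn_integral_has_integral_lebesgue'[where I=4]) auto
  have \<psi>1: "(\<integral>\<^sup>+ y. \<psi> (y - x) \<partial>lborel) = 4" for x
    using nn_integral_real_affine[of "\<lambda>y. \<psi> (y - x)" 1 x] \<psi> by simp
  have \<psi>2: "(\<integral>\<^sup>+ y. \<psi> (x - y) \<partial>lborel) = 4" for x
    using nn_integral_real_affine[of "\<lambda>y. \<psi> (x - y)" "-1" x] \<psi> by simp
  have bound: "ennreal (max 0 (- ln \<bar>x - y\<bar>)) \<le> \<psi> (y - x) + \<psi> (x - y)" if "y \<noteq> x" for x y
  proof (cases "\<bar>x - y\<bar> \<le> 1")
    case False
    then show ?thesis by simp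
  next
    case True
    define u where "u = \<bar>x - y\<bar>"
    have u: "0 < u" "u \<le> 1" using True that by (auto simp: u_def)
    have "- ln u = 2 * ln (u powr (- 1 / 2))" using u by (simp add: ln_powr)
    also have "\<dots> \<le> 2 * u powr (- 1 / 2)"
      using ln_le_minus_one[of "u powr (- 1 / 2)"] u by simp
    finally have "ennreal (max 0 (- ln u)) \<le> \<psi> u"
      using u by (auto simp: \<psi>_def intro!: ennreal_leI)
    moreover have "\<psi> u \<le> \<psi> (y - x) + \<psi> (x - y)"
      unfolding u_def by (cases "x \<le> y") (auto simp: abs_if)
    ultimately show ?thesis unfolding u_def by (rule order_trans)
  qed
  have "(\<integral>\<^sup>+ y. (if y = x then \<infinity> else ennreal (max 0 (- ln \<bar>x - y\<bar>))) \<partial>lborel) \<le> 8" for x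
  proof -
    have "(\<integral>\<^sup>+ y. (if y = x then \<infinity> else ennreal (max 0 (- ln \<bar>x - y\<bar>))) \<partial>lborel)
        \<le> (\<integral>\<^sup>+ y. \<psi> (y - x) + \<psi> (x - y) \<partial>lborel)"
      by (intro nn_integral_mono_AE eventually_mono[OF AE_lborel_singleton[of x]]) (use bound in auto)
    also have "\<dots> = 8" by (simp add: nn_integral_add \<psi>1 \<psi>2)
    finally show ?thesis .
  qed
  then show thesis by (rule that[rotated]) (simp add: less_top[symmetric])
qed

text \<open>\<open>s x\<close> is the first time at which \<open>h\<close> reaches the level
  \<open>x\<close>. The level is hit exactly, since by the intermediate value theorem an overshoot
  would have been preceded by a hit; and a higher level is reached later. Monotonicity is wanted
  because it makes the section Borel, although it may jump.\<close>

lemma continuous_monotone_section: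
  fixes h :: "real \<Rightarrow> real"
  assumes "continuous_on {0..1} h" "h 0 \<le> h 1"
  obtains s where "mono_on {h 0..h 1} s" "\<And>x. x \<in> {h 0..h 1} \<Longrightarrow> s x \<in> {0..1} \<and> h (s x) = x"
proof
  define T where "T x = {t\<in>{0..1}. x \<le> h t}" for x
  have T: "Inf (T x) \<in> T x" "Inf (T x) \<in> {0..1}" "h (Inf (T x)) = x" "bdd_below (T x)" if x: "x \<in> {h 0..h 1}" for x
  proof -
    have ne: "T x \<noteq> {}" using x unfolding T_def by (force intro: exI[of _ 1])
    show bb: "bdd_below (T x)" by (auto simp: T_def intro: bdd_belowI[of _ 0])
    have "closed (T x)"
    proof -
      have "T x = {0..1} \<inter> h -` {x..}" by (auto simp: T_def)
      then show ?thesis using continuous_closed_preimage[OF assms(1), of "{x..}"] by simp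
    qed
    then show i: "Inf (T x) \<in> T x" using closed_contains_Inf[OF ne bb] by blast
    then show j: "Inf (T x) \<in> {0..1}" by (simp add: T_def)
    show "h (Inf (T x)) = x"
    proof (rule ccontr)
      assume "h (Inf (T x)) \<noteq> x"
      then have gt: "x < h (Inf (T x))" using i by (simp add: T_def)
      have "continuous_on {0..Inf (T x)} h" using assms(1) j by (auto elim: continuous_on_subset)
      then obtain t where t: "0 \<le> t" "t \<le> Inf (T x)" "h t = x"
        using IVT'[of h 0 x "Inf (T x)"] x gt j by auto
      then have "t \<in> T x" using j by (auto simp: T_def)
      then have "Inf (T x) \<le> t" by (rule cInf_lower[OF _ bb])
      then show False using t gt by auto
    qed
  qed
  show "mono_on {h 0..h 1} (\<lambda>x. Inf (T x))"
  proof (rule mono_onI)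
    fix x y assume "x \<in> {h 0..h 1}" "y \<in> {h 0..h 1}" "x \<le> y"
    then show "Inf (T x) \<le> Inf (T y)"
      using T(1)[of y] T(4)[of x] by (intro cInf_lower) (auto simp: T_def)
  qed
  show "Inf (T x) \<in> {0..1} \<and> h (Inf (T x)) = x" if "x \<in> {h 0..h 1}" for x
    using T that by blast
qed

text \<open>Lifting Lebesgue measure on an interval through a contraction \<open>\<pi>\<close> onto the real line yields a
  measure of finite energy, since \<open>\<pi>\<close> only increases the logarithmic kernel.\<close>

lemma not_polar_path_contraction:
  fixes g :: "real \<Rightarrow> complex" and \<pi> :: "complex \<Rightarrow> real"
  assumes g: "continuous_on {0..1} g" and V: "Fin ` g ` {0..1} \<subseteq> V"
    and \<pi>: "\<And>z w. \<bar>\<pi> z - \<pi> w\<bar> \<le> cmod (z - w)" and lt: "\<pi> (g 0) < \<pi> (g 1)"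
  shows "\<not> polar V"
proof
  assume pol: "polar V"
  define a b where "a = \<pi> (g 0)" and "b = \<pi> (g 1)"
  have "continuous_on UNIV \<pi>"
    unfolding continuous_on_iff using \<pi> by (metis dist_norm dist_real_def le_less_trans)
  then have "continuous_on {0..1} (\<lambda>t. \<pi> (g t))"
    using continuous_on_compose2[OF _ g, of UNIV \<pi>] by blast
  from continuous_monotone_section[OF this] lt obtain s where
    s: "mono_on {a..b} s" "\<And>x. x \<in> {a..b} \<Longrightarrow> s x \<in> {0..1} \<and> \<pi> (g (s x)) = x"
    by (auto simp: a_def b_def)
  let ?L = "restrict_space lborel {a..b}"
  \<comment> \<open>A Borel choice of a point on the path above each \<open>x\<close>, with
    \<open>\<pi> (G x) = x\<close>; it serves to push Lebesgue measure on \<open>[a, b]\<close> onto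
    the path.\<close>
  define G where "G x = g (s x)" for x
  have "s \<in> ?L \<rightarrow>\<^sub>M restrict_space borel {0..1}"
    using borel_measurable_mono_on_fnc[OF s(1)] s(2)
    by (intro measurable_restrict_space2)
      (auto simp: space_restrict_space cong: measurable_cong_sets sets_restrict_space_cong)
  then have G[measurable]: "G \<in> ?L \<rightarrow>\<^sub>M borel"
    unfolding G_def by (rule measurable_compose) (rule borel_measurable_continuous_on_restrict[OF g])
  define \<nu> where "\<nu> = distr ?L borel G"
  have emL: "emeasure ?L (space ?L) = ennreal (b - a)"
    using lt by (simp add: emeasure_restrict_space space_restrict_space a_def b_def)
  have em: "emeasure \<nu> UNIV = ennreal (b - a)"
    unfolding \<nu>_def using emL by (subst emeasure_distr[OF G]) auto
  have "finite_measure \<nu>" by (rule finite_measureI) (simp add: \<nu>_def[symmetric] em, simp add: \<nu>_def em[unfolded \<nu>_def])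
  moreover have "compact (g ` {0..1})" by (rule compact_continuous_image[OF g]) simp
  moreover have "emeasure \<nu> (- g ` {0..1}) = 0"
  proof -
    have "- g ` {0..1} \<in> sets borel" using \<open>compact (g ` {0..1})\<close> by (intro borel_open open_Compl compact_imp_closed)
    moreover have "G -` (- g ` {0..1}) \<inter> space ?L = {}"
      using s(2) by (auto simp: G_def space_restrict_space)
    ultimately show ?thesis by (simp add: \<nu>_def emeasure_distr[OF G])
  qed
  moreover have "sets \<nu> = sets borel" by (simp add: \<nu>_def)
  moreover have "emeasure \<nu> UNIV \<noteq> 0" using em lt by (simp add: a_def b_def)
  ultimately have inf: "(\<integral>\<^sup>+ z. \<integral>\<^sup>+ w. log_kernel z w \<partial>\<nu> \<partial>\<nu>) = \<infinity>"
    using pol V unfolding polar_def by blast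
  obtain C where C: "C < \<infinity>"
    "\<And>x. (\<integral>\<^sup>+ y. (if y = x then \<infinity> else ennreal (max 0 (- ln \<bar>x - y\<bar>))) \<partial>lborel) \<le> C"
    using nn_integral_log_singularity_finite by blast
  \<comment> \<open>A bound on the potential uniform in \<open>z\<close> suffices for the energy,
    since \<nu> has finite mass \<open>b - a\<close>.\<close>
  have inner: "(\<integral>\<^sup>+ w. log_kernel z w \<partial>\<nu>) \<le> C" for z
  proof -
    have [measurable]: "log_kernel z \<in> borel_measurable borel" unfolding log_kernel_def by measurable
    have "(\<integral>\<^sup>+ w. log_kernel z w \<partial>\<nu>) = (\<integral>\<^sup>+ y. log_kernel z (G y) \<partial>?L)"
      unfolding \<nu>_def by (rule nn_integral_distr) auto
    also have "\<dots> \<le> (\<integral>\<^sup>+ y. (if y = \<pi> z then \<infinity> else ennreal (max 0 (- ln \<bar>\<pi> z - y\<bar>))) \<partial>?L)"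
    proof (rule nn_integral_mono)
      fix y assume "y \<in> space ?L"
      then have y: "\<pi> (G y) = y" using s(2)[of y] by (simp add: G_def space_restrict_space)
      show "log_kernel z (G y) \<le> (if y = \<pi> z then \<infinity> else ennreal (max 0 (- ln \<bar>\<pi> z - y\<bar>)))"
      proof (cases "y = \<pi> z")
        case False
        then have "z \<noteq> G y" "0 < \<bar>\<pi> z - y\<bar>" using y by auto
        moreover have "\<bar>\<pi> z - y\<bar> \<le> cmod (z - G y)" using \<pi>[of z "G y"] y by simp
        ultimately have "ln \<bar>\<pi> z - y\<bar> \<le> ln (cmod (z - G y))" by (intro ln_mono) auto
        then show ?thesis using False \<open>z \<noteq> G y\<close> by (auto simp: log_kernel_def intro!: ennreal_leI)
      qed auto
    qed
    also have "\<dots> = (\<integral>\<^sup>+ y. (if y = \<pi> z then \<infinity> else ennreal (max 0 (- ln \<bar>\<pi> z - y\<bar>))) * indicator {a..b} y \<partial>lborel)"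
      by (rule nn_integral_restrict_space) simp
    also have "\<dots> \<le> (\<integral>\<^sup>+ y. (if y = \<pi> z then \<infinity> else ennreal (max 0 (- ln \<bar>\<pi> z - y\<bar>))) \<partial>lborel)"
      by (intro nn_integral_mono) (auto split: split_indicator)
    also have "\<dots> \<le> C" by (rule C(2))
    finally show ?thesis .
  qed
  have "(\<integral>\<^sup>+ z. \<integral>\<^sup>+ w. log_kernel z w \<partial>\<nu> \<partial>\<nu>) \<le> (\<integral>\<^sup>+ z. C \<partial>\<nu>)"
    by (intro nn_integral_mono inner)
  also have "\<dots> = C * ennreal (b - a)" using em by (simp add: \<nu>_def)
  also have "\<dots> < \<infinity>" using C(1) by (simp add: ennreal_mult_less_top)
  finally show False using inf by simp
qed

text \<open>\<open>Re\<close> or \<open>Im\<close> separates the endpoints, and a change of sign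
  puts their values in increasing order.\<close>

lemma not_polar_path:
  fixes g :: "real \<Rightarrow> complex"
  assumes g: "continuous_on {0..1} g" and V: "Fin ` g ` {0..1} \<subseteq> V" and ne: "g 0 \<noteq> g 1"
  shows "\<not> polar V"
proof -
  have *: "\<not> polar V" if \<pi>: "\<And>z w. \<bar>\<pi> z - \<pi> w\<bar> \<le> cmod (z - w)" and lt: "\<pi> (g 0) \<noteq> \<pi> (g 1)"
    for \<pi> :: "complex \<Rightarrow> real"
  proof (cases "\<pi> (g 0) < \<pi> (g 1)")
    case True
    then show ?thesis using not_polar_path_contraction[OF g V \<pi>] by blast
  next
    case False
    have "\<bar>(- \<pi> z) - (- \<pi> w)\<bar> \<le> cmod (z - w)" for z w using \<pi>[of z w] by linarith
    moreover have "- \<pi> (g 0) < - \<pi> (g 1)" using False lt by simp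
    ultimately show ?thesis using not_polar_path_contraction[OF g V, of "\<lambda>z. - \<pi> z"] by blast
  qed
  show ?thesis
  proof (cases "Re (g 0) = Re (g 1)")
    case False
    then show ?thesis using *[of Re] abs_Re_le_cmod by (metis minus_complex.sel(1))
  next
    case True
    then have "Im (g 0) \<noteq> Im (g 1)" using ne complex_eqI by blast
    then show ?thesis using *[of Im] abs_Im_le_cmod by (metis minus_complex.sel(2))
  qed
qed

text \<open>Polarity is defined through subsets of the plane, but the loop may pass through
  \<open>Infty\<close>. The arcs with angles in \<open>[0, 1/2]\<close> and \<open>[1, 3/2]\<close>
  are disjoint, so at least one avoids \<open>Infty\<close> and is a planar path with distinct
  endpoints.\<close>

lemma not_polar_simple_loop:
  assumes "\<gamma> \<in> simple_loops" "\<gamma> \<subseteq> V" shows "\<not> polar V"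
proof -
  obtain h k where hk: "homeomorphism (sphere (0::complex) 1) \<gamma> h k"
    using assms(1) homeomorphic_sym unfolding simple_loops_def homeomorphic_def by blast
  have inj: "inj_on h (sphere 0 1)" using hk by (metis homeomorphism_apply1 inj_on_inverseI)
  \<comment> \<open>\<open>cos\<close> is injective on \<open>[0, pi]\<close>, which contains
    \<open>[0, 2]\<close>.\<close>
  have cis_inj: "x = y" if "cis x = cis y" "0 \<le> x" "x \<le> 2" "0 \<le> y" "y \<le> 2" for x y
  proof -
    have "cos x = cos y" using that(1) by (simp add: complex_eq_iff)
    then show ?thesis using that(2-) pi_ge_two by (auto intro: cos_inj_pi)
  qed
  have h_inj: "x = y" if "h (cis x) = h (cis y)" "0 \<le> x" "x \<le> 2" "0 \<le> y" "y \<le> 2" for x y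
    using cis_inj[OF _ that(2-)] inj that(1) by (simp add: inj_on_def)
  obtain t0 :: real where t0: "t0 = 0 \<or> t0 = 1" "\<And>t. t \<in> {0..1} \<Longrightarrow> h (cis (t0 + t / 2)) \<noteq> Infty"
  proof (cases "\<exists>t\<in>{0..1}. h (cis (t / 2)) = Infty")
    case False
    then show thesis using that[of 0] by auto
  next
    case True
    then obtain t where t: "t \<in> {0..1}" "h (cis (t / 2)) = Infty" by blast
    have "h (cis (1 + u / 2)) \<noteq> Infty" if "u \<in> {0..1}" for u
    proof
      assume "h (cis (1 + u / 2)) = Infty"
      then have "1 + u / 2 = t / 2" using h_inj[of "1 + u / 2" "t / 2"] t that by simp
      then show False using t(1) that by simp
    qed
    then show thesis using that[of 1] by blast
  qed
  define g where "g t = affine_part (h (cis (t0 + t / 2)))" for t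
  have Fg: "Fin (g t) = h (cis (t0 + t / 2))" if "t \<in> {0..1}" for t
    using t0(2)[OF that] unfolding g_def by (cases "h (cis (t0 + t / 2))") auto
  have c1: "continuous_on {0..1} (\<lambda>t. h (cis (t0 + t / 2)))"
    by (rule continuous_on_compose2[OF homeomorphism_cont1[OF hk]]) (auto intro!: continuous_intros)
  have "continuous_on {0..1} g"
    unfolding g_def
    by (rule continuous_on_compose2[OF continuous_on_affine_part c1 subset_refl]) (use t0(2) in force)
  moreover have "h (cis \<theta>) \<in> \<gamma>" for \<theta>
    using homeomorphism_image1[OF hk] by (metis dist_0_norm imageI mem_sphere norm_cis)
  then have "Fin ` g ` {0..1} \<subseteq> V" using Fg assms(2) by auto
  moreover have "g 0 \<noteq> g 1"
  proof
    assume "g 0 = g 1"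
    then have "h (cis (t0 + 0 / 2)) = h (cis (t0 + 1 / 2))" using Fg[of 0] Fg[of 1] by simp
    then have "t0 + 0 / 2 = t0 + 1 / 2" by (rule h_inj) (use t0(1) in auto)
    then show False by simp
  qed
  ultimately show ?thesis by (rule not_polar_path)
qed

section \<open>The cascade relation\<close>

lemma connected_simple_loop: "\<gamma> \<in> simple_loops \<Longrightarrow> connected \<gamma>"
  using homeomorphic_connectedness[of \<gamma> "sphere (0::complex) 1"] connected_sphere[of "0::complex" 1]
  by (simp add: simple_loops_def)

lemma simple_loop_subset_component:
  assumes "\<gamma>1 \<in> simple_loops" "\<gamma>2 \<in> simple_loops" "\<gamma>1 \<inter> \<gamma>2 = {}"
  obtains D where "D \<in> components (- \<gamma>1)" "\<gamma>2 \<subseteq> D"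
  using exists_component_superset[of \<gamma>2 "- \<gamma>1"] connected_simple_loop[OF assms(2)]
    simple_loops_nonempty[OF assms(2)] assms(3) by blast

lemma space_brownian_loop_measure: "space (brownian_loop_measure Pbr) = unroot ` rooted_loops"
  unfolding brownian_loop_measure_def Let_def space_distr by (rule space_measure_of) blast

text \<open>A Brownian loop that meets \<open>\<gamma>2 \<subseteq> D\<close> and leaves \<open>D\<close> crosses the boundary of \<open>D\<close>, which is
  contained in \<open>\<gamma>1\<close>.\<close>

lemma Lambda_star_component_complement:
  assumes "\<gamma>1 \<in> simple_loops" "\<gamma>2 \<in> simple_loops" "D \<in> components (- \<gamma>1)" "\<gamma>2 \<subseteq> D"
  shows "Lambda_star Pbr \<gamma>2 (- D) = Lambda_star Pbr \<gamma>1 \<gamma>2"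
proof -
  have fr: "frontier D \<subseteq> \<gamma>1"
    using frontier_component_subset_rsphere[OF compact_imp_closed[OF simple_loops_compact[OF assms(1)]] assms(3)] .
  have sub: "\<gamma>1 \<subseteq> - D" using in_components_subset[OF assms(3)] by blast
  have *: "Fin ` loop_trace L \<inter> \<gamma>2 \<noteq> {} \<and> Fin ` loop_trace L \<inter> - D \<noteq> {}
      \<longleftrightarrow> Fin ` loop_trace L \<inter> \<gamma>1 \<noteq> {} \<and> Fin ` loop_trace L \<inter> \<gamma>2 \<noteq> {}"
    if L: "L \<in> space (brownian_loop_measure Pbr)" for L
  proof -
    obtain l where "l \<in> rooted_loops" "L = unroot l"
      using L by (auto simp: space_brownian_loop_measure)
    then have con: "connected (Fin ` loop_trace L)"
      using connected_continuous_image[OF continuous_on_Fin connected_range_rooted_loop]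
      by (simp add: loop_trace_unroot)
    have "Fin ` loop_trace L \<inter> frontier D \<noteq> {}"
      if "Fin ` loop_trace L \<inter> \<gamma>2 \<noteq> {}" "Fin ` loop_trace L \<inter> - D \<noteq> {}"
      using connected_Int_frontier[OF con, of D] that assms(4) by blast
    then show ?thesis using fr sub by blast
  qed
  \<comment> \<open>The events coincide for every confining set \<open>B\<close>, so the functions
    of the radius are equal and no convergence is involved.\<close>
  have "brownian_loop_mass Pbr B \<gamma>2 (- D) = brownian_loop_mass Pbr B \<gamma>1 \<gamma>2" for B
    unfolding brownian_loop_mass_def by (intro arg_cong[where f="emeasure _"] Collect_cong) (use * in blast)
  then show ?thesis unfolding Lambda_star_def by simp
qed

section \<open>The weight of a pair and the sum over components\<close>

definition loop_pair_weight ::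
  "(complex \<Rightarrow> real \<Rightarrow> (real \<Rightarrow> complex) measure) \<Rightarrow> real \<Rightarrow> rsphere set \<times> rsphere set \<Rightarrow> ennreal" where
  "loop_pair_weight Pbr c p =
    (if fst p \<inter> snd p = {} then ennreal (exp (c / 2 * Lambda_star Pbr (fst p) (snd p))) else 0)"

lemma two_loop_measure_eq_density: "two_loop_measure Pbr c \<mu> = density (\<mu> \<Otimes>\<^sub>M \<mu>) (loop_pair_weight Pbr c)"
  unfolding two_loop_measure_def
  by (intro arg_cong[where f="density _"]) (auto simp: fun_eq_iff loop_pair_weight_def)

lemma measurable_loop_pair_weight:
  assumes "\<And>z t. 0 < t \<Longrightarrow> brownian_bridge_law z t (Pbr z t)"
  shows "loop_pair_weight Pbr c \<in> borel_measurable (loop_borel \<Otimes>\<^sub>M loop_borel)"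
proof -
  note [measurable] = measurable_Lambda_star[OF assms]
  have [measurable]: "Measurable.pred (loop_borel \<Otimes>\<^sub>M loop_borel) (\<lambda>p. fst p \<inter> snd p = {})"
    using sets_loops_disjoint by (simp add: pred_def)
  show ?thesis unfolding loop_pair_weight_def[abs_def] by measurable
qed

text \<open>Turns the sum over components into an integral, to which Tonelli's theorem for counting
  measure applies.\<close>

lemma infsum_ennreal_eq_nn_integral:
  fixes f :: "'a \<Rightarrow> ennreal"
  assumes "countable A"
  shows "infsum f A = (\<integral>\<^sup>+ x. f x \<partial>count_space A)"
proof (cases "finite A")
  case True
  then show ?thesis by (simp add: nn_integral_count_space_finite)
next
  case False
  have bij: "bij_betw (from_nat_into A) UNIV A" by (rule bij_betw_from_nat_into[OF assms False])
  have "infsum f A = (\<Sum>\<^sub>\<infinity>n. f (from_nat_into A n))"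
    by (rule infsum_reindex_bij_betw[OF bij, symmetric])
  also have "\<dots> = (\<Sum>n. f (from_nat_into A n))"
    by (rule sums_unique[OF has_sum_imp_sums[OF has_sum_infsum]]) (rule nonneg_summable_on_complete, simp)
  also have "\<dots> = (\<integral>\<^sup>+ x. f x \<partial>count_space A)"
    by (simp only: nn_integral_count_space_nat[symmetric] nn_integral_bij_count_space[OF bij])
  finally show ?thesis .
qed

text \<open>The setting shared by the cascade relation, uniqueness and invariance; conformal
  invariance enters as a separate assumption of
  \<open>moebius_invariant_two_loop_measure\<close>.\<close>

locale loop_measure =
  fixes Pbr :: "complex \<Rightarrow> real \<Rightarrow> (real \<Rightarrow> complex) measure" and c :: real
    and \<mu> :: "rsphere set measure"
  assumes bridge: "\<And>z t. 0 < t \<Longrightarrow> brownian_bridge_law z t (Pbr z t)"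
    and sets_\<mu> [measurable_cong]: "sets \<mu> = sets loop_borel"
    and locally_finite: "locally_finite_loop_measure \<mu>"
begin

sublocale sigma_finite_measure \<mu>
  by (rule sigma_finite_locally_finite_loop_measure[OF sets_\<mu> locally_finite])

abbreviation "w \<equiv> loop_pair_weight Pbr c"
abbreviation "\<mu>_in \<equiv> loop_measure_in Pbr c \<mu>"

lemmas measurable_w [measurable] = measurable_loop_pair_weight[OF bridge, of c]

lemma space_\<mu>: "space \<mu> = simple_loops"
  using sets_eq_imp_space_eq[OF sets_\<mu>] by (simp add: space_loop_borel)

lemma sets_pair_\<mu>: "sets (\<mu> \<Otimes>\<^sub>M \<mu>) = sets (loop_borel \<Otimes>\<^sub>M loop_borel)"
  by (rule sets_pair_measure_cong[OF sets_\<mu> sets_\<mu>])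

lemma sets_loops_in: "open D \<Longrightarrow> {\<gamma>. \<gamma> \<subseteq> D} \<inter> space \<mu> \<in> sets \<mu>"
  using sets_loops_subset_open[of D] by (simp add: sets_\<mu> space_\<mu> Int_def conj_commute)

lemma space_loop_measure_in: "space (\<mu>_in D) = {\<gamma>\<in>simple_loops. \<gamma> \<subseteq> D}"
  by (auto simp: loop_measure_in_def space_restrict_space space_\<mu>)

lemma sets_loop_measure_in: "sets (\<mu>_in D) = sets (restrict_space loop_borel {\<gamma>. \<gamma> \<subseteq> D})"
  by (simp add: loop_measure_in_def sets_restrict_space sets_\<mu>)

text \<open>The complement of \<open>D\<close> contains \<open>\<gamma>1\<close> and so is not
  polar, which selects the exponential branch of \<open>loop_measure_in\<close>; on loops in
  \<open>D\<close> that branch is the weight of the pair. Afterwards \<open>D\<close> occurs only in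
  an indicator, ready for summation.\<close>

lemma emeasure_loop_measure_in_component:
  assumes \<gamma>1: "\<gamma>1 \<in> simple_loops" and D: "D \<in> components (- \<gamma>1)"
    and A[measurable]: "A \<in> sets (loop_borel \<Otimes>\<^sub>M loop_borel)"
  shows "emeasure (\<mu>_in D) {\<gamma>2\<in>space (\<mu>_in D). (\<gamma>1, \<gamma>2) \<in> A}
    = (\<integral>\<^sup>+ \<gamma>2. w (\<gamma>1, \<gamma>2) * indicator A (\<gamma>1, \<gamma>2) * indicator {\<gamma>. \<gamma> \<subseteq> D} \<gamma>2 \<partial>\<mu>)"
proof -
  let ?S = "{\<gamma>. \<gamma> \<subseteq> D}"
  let ?N = "restrict_space \<mu> ?S"
  let ?X = "{\<gamma>2\<in>space ?N. (\<gamma>1, \<gamma>2) \<in> A}"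
  have S: "?S \<inter> space \<mu> \<in> sets \<mu>"
    using open_components_rsphere[OF _ D] simple_loops_compact[OF \<gamma>1]
    by (intro sets_loops_in) (auto intro: compact_imp_closed)
  have pair: "Pair \<gamma>1 \<in> \<mu> \<rightarrow>\<^sub>M loop_borel \<Otimes>\<^sub>M loop_borel"
    using \<gamma>1 by (intro measurable_Pair) (simp_all add: space_loop_borel sets_\<mu> cong: measurable_cong_sets)
  have wm: "(\<lambda>\<gamma>2. w (\<gamma>1, \<gamma>2)) \<in> borel_measurable ?N"
    by (intro measurable_restrict_space1 measurable_compose[OF pair measurable_w])
  have X: "?X \<in> sets ?N"
    using measurable_sets[OF measurable_restrict_space1[OF pair] A, of ?S]
    by (simp add: vimage_def Int_def conj_commute)
  have np: "\<not> polar (- D)"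
    using not_polar_simple_loop[OF \<gamma>1] in_components_subset[OF D] by blast
  have eq: "(if polar (- D) then 1 else ennreal (exp (c / 2 * Lambda_star Pbr \<gamma>2 (- D)))) = w (\<gamma>1, \<gamma>2)"
    if "\<gamma>2 \<in> space ?N" for \<gamma>2
  proof -
    have \<gamma>2: "\<gamma>2 \<in> simple_loops" "\<gamma>2 \<subseteq> D" using that by (auto simp: space_restrict_space space_\<mu>)
    then have "\<gamma>1 \<inter> \<gamma>2 = {}" using in_components_subset[OF D] by blast
    then show ?thesis
      using np Lambda_star_component_complement[OF \<gamma>1 \<gamma>2(1) D \<gamma>2(2)] by (simp add: loop_pair_weight_def)
  qed
  have "\<mu>_in D = density ?N (\<lambda>\<gamma>2. w (\<gamma>1, \<gamma>2))"
    unfolding loop_measure_in_def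
    by (intro density_cong AE_I2 eq) (use wm eq in \<open>simp_all cong: measurable_cong_simp\<close>)
  then have "emeasure (\<mu>_in D) {\<gamma>2\<in>space (\<mu>_in D). (\<gamma>1, \<gamma>2) \<in> A}
      = emeasure (density ?N (\<lambda>\<gamma>2. w (\<gamma>1, \<gamma>2))) ?X" by simp
  also have "\<dots> = (\<integral>\<^sup>+ \<gamma>2. w (\<gamma>1, \<gamma>2) * indicator ?X \<gamma>2 \<partial>?N)"
    by (rule emeasure_density[OF wm X])
  also have "\<dots> = (\<integral>\<^sup>+ \<gamma>2. w (\<gamma>1, \<gamma>2) * indicator A (\<gamma>1, \<gamma>2) \<partial>?N)"
    by (intro nn_integral_cong) (auto split: split_indicator)
  also have "\<dots> = (\<integral>\<^sup>+ \<gamma>2. w (\<gamma>1, \<gamma>2) * indicator A (\<gamma>1, \<gamma>2) * indicator ?S \<gamma>2 \<partial>\<mu>)"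
    by (rule nn_integral_restrict_space[OF S])
  finally show ?thesis .
qed

text \<open>For a loop disjoint from \<open>\<gamma>1\<close> exactly one component indicator is 1,
  and for any other loop the weight vanishes. The identity is kept pointwise in
  \<open>\<gamma>1\<close> because Moebius invariance uses it both at a loop and at its
  image.\<close>

lemma cascade_sum:
  assumes \<gamma>1: "\<gamma>1 \<in> simple_loops" and A: "A \<in> sets (loop_borel \<Otimes>\<^sub>M loop_borel)"
  shows "(\<Sum>\<^sub>\<infinity>D\<in>components (- \<gamma>1). emeasure (\<mu>_in D) {\<gamma>2\<in>space (\<mu>_in D). (\<gamma>1, \<gamma>2) \<in> A})
    = (\<integral>\<^sup>+ \<gamma>2. w (\<gamma>1, \<gamma>2) * indicator A (\<gamma>1, \<gamma>2) \<partial>\<mu>)"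
proof -
  let ?I = "components (- \<gamma>1)"
  let ?f = "\<lambda>\<gamma>2. w (\<gamma>1, \<gamma>2) * indicator A (\<gamma>1, \<gamma>2)"
  have op: "open (- \<gamma>1)" using simple_loops_compact[OF \<gamma>1] by (auto intro: compact_imp_closed)
  have cI: "countable ?I" by (rule countable_components_rsphere[OF op])
  have pair: "Pair \<gamma>1 \<in> \<mu> \<rightarrow>\<^sub>M loop_borel \<Otimes>\<^sub>M loop_borel"
    using \<gamma>1 by (intro measurable_Pair) (simp_all add: space_loop_borel sets_\<mu> cong: measurable_cong_sets)
  have fm: "?f \<in> borel_measurable \<mu>"
    by (intro borel_measurable_times_ennreal measurable_compose[OF pair] measurable_w borel_measurable_indicator A)
  have "(\<Sum>\<^sub>\<infinity>D\<in>?I. emeasure (\<mu>_in D) {\<gamma>2\<in>space (\<mu>_in D). (\<gamma>1, \<gamma>2) \<in> A})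
      = (\<Sum>\<^sub>\<infinity>D\<in>?I. \<integral>\<^sup>+ \<gamma>2. ?f \<gamma>2 * indicator {\<gamma>. \<gamma> \<subseteq> D} \<gamma>2 \<partial>\<mu>)"
    by (intro infsum_cong emeasure_loop_measure_in_component[OF \<gamma>1 _ A])
  also have "\<dots> = (\<integral>\<^sup>+ D. \<integral>\<^sup>+ \<gamma>2. ?f \<gamma>2 * indicator {\<gamma>. \<gamma> \<subseteq> D} \<gamma>2 \<partial>\<mu> \<partial>count_space ?I)"
    by (rule infsum_ennreal_eq_nn_integral[OF cI])
  also have "\<dots> = (\<integral>\<^sup>+ \<gamma>2. \<integral>\<^sup>+ D. ?f \<gamma>2 * indicator {\<gamma>. \<gamma> \<subseteq> D} \<gamma>2 \<partial>count_space ?I \<partial>\<mu>)"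
  proof (rule nn_integral_count_space_nn_integral[OF cI, symmetric])
    fix D assume "D \<in> ?I"
    then have "{\<gamma>. \<gamma> \<subseteq> D} \<inter> space \<mu> \<in> sets \<mu>"
      by (intro sets_loops_in open_components_rsphere[OF op])
    then have "(indicator {\<gamma>. \<gamma> \<subseteq> D} :: _ \<Rightarrow> ennreal) \<in> borel_measurable \<mu>"
      by (simp add: borel_measurable_indicator_iff)
    then show "(\<lambda>\<gamma>2. ?f \<gamma>2 * indicator {\<gamma>. \<gamma> \<subseteq> D} \<gamma>2) \<in> borel_measurable \<mu>"
      by (intro borel_measurable_times_ennreal fm)
  qed
  also have "\<dots> = (\<integral>\<^sup>+ \<gamma>2. ?f \<gamma>2 \<partial>\<mu>)"
  proof (rule nn_integral_cong)
    fix \<gamma>2 assume "\<gamma>2 \<in> space \<mu>"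
    then have \<gamma>2: "\<gamma>2 \<in> simple_loops" by (simp add: space_\<mu>)
    show "(\<integral>\<^sup>+ D. ?f \<gamma>2 * indicator {\<gamma>. \<gamma> \<subseteq> D} \<gamma>2 \<partial>count_space ?I) = ?f \<gamma>2"
    proof (cases "\<gamma>1 \<inter> \<gamma>2 = {}")
      case False
      then show ?thesis by (simp add: loop_pair_weight_def)
    next
      case True
      obtain D where D: "D \<in> ?I" "\<gamma>2 \<subseteq> D"
        using simple_loop_subset_component[OF \<gamma>1 \<gamma>2 True] .
      have "\<not> \<gamma>2 \<subseteq> E" if "E \<in> ?I" "E \<noteq> D" for E
        using components_nonoverlap[OF that(1) D(1)] that(2) D(2) simple_loops_nonempty[OF \<gamma>2] by blast
      then have "(\<integral>\<^sup>+ E. ?f \<gamma>2 * indicator {\<gamma>. \<gamma> \<subseteq> E} \<gamma>2 \<partial>count_space ?I)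
          = (\<Sum>E\<in>{D}. ?f \<gamma>2 * indicator {\<gamma>. \<gamma> \<subseteq> E} \<gamma>2)"
        using D(1) by (intro nn_integral_count_space') auto
      then show ?thesis using D(2) by simp
    qed
  qed
  finally show ?thesis .
qed

lemma emeasure_two_loop_measure:
  assumes A: "A \<in> sets (loop_borel \<Otimes>\<^sub>M loop_borel)"
  shows "emeasure (two_loop_measure Pbr c \<mu>) A
    = (\<integral>\<^sup>+ \<gamma>1. \<integral>\<^sup>+ \<gamma>2. w (\<gamma>1, \<gamma>2) * indicator A (\<gamma>1, \<gamma>2) \<partial>\<mu> \<partial>\<mu>)"
proof -
  have wm: "w \<in> borel_measurable (\<mu> \<Otimes>\<^sub>M \<mu>)"
    using measurable_w by (simp add: sets_pair_\<mu> cong: measurable_cong_sets)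
  have A': "A \<in> sets (\<mu> \<Otimes>\<^sub>M \<mu>)" using A by (simp add: sets_pair_\<mu>)
  have "emeasure (two_loop_measure Pbr c \<mu>) A = (\<integral>\<^sup>+ p. w p * indicator A p \<partial>(\<mu> \<Otimes>\<^sub>M \<mu>))"
    unfolding two_loop_measure_eq_density by (rule emeasure_density[OF wm A'])
  also have "\<dots> = (\<integral>\<^sup>+ \<gamma>1. \<integral>\<^sup>+ \<gamma>2. w (\<gamma>1, \<gamma>2) * indicator A (\<gamma>1, \<gamma>2) \<partial>\<mu> \<partial>\<mu>)"
    by (rule nn_integral_fst[symmetric]) (intro borel_measurable_times_ennreal wm borel_measurable_indicator A')
  finally show ?thesis .
qed

lemma cascade_relation_two_loop_measure: "cascade_relation Pbr c \<mu> (two_loop_measure Pbr c \<mu>)"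
  unfolding cascade_relation_def
proof
  fix A assume A: "A \<in> sets (loop_borel \<Otimes>\<^sub>M loop_borel)"
  show "emeasure (two_loop_measure Pbr c \<mu>) A = (\<integral>\<^sup>+ \<gamma>1. (\<Sum>\<^sub>\<infinity>D\<in>components (- \<gamma>1).
            emeasure (\<mu>_in D) {\<gamma>2\<in>space (\<mu>_in D). (\<gamma>1, \<gamma>2) \<in> A}) \<partial>\<mu>)"
    unfolding emeasure_two_loop_measure[OF A]
    by (intro nn_integral_cong cascade_sum[symmetric] A) (simp add: space_\<mu>)
qed

lemma sets_two_loop_measure: "sets (two_loop_measure Pbr c \<mu>) = sets (loop_borel \<Otimes>\<^sub>M loop_borel)"
  by (simp add: two_loop_measure_eq_density sets_pair_\<mu>)

lemma disjoint_loop_pair_measure_two_loop_measure: "disjoint_loop_pair_measure (two_loop_measure Pbr c \<mu>)"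
proof -
  have wm: "w \<in> borel_measurable (\<mu> \<Otimes>\<^sub>M \<mu>)"
    using measurable_w by (simp add: sets_pair_\<mu> cong: measurable_cong_sets)
  have "AE p in two_loop_measure Pbr c \<mu>. fst p \<inter> snd p = {}"
    unfolding two_loop_measure_eq_density AE_density[OF wm] by (simp add: loop_pair_weight_def)
  then show ?thesis
    by (simp add: disjoint_loop_pair_measure_def sets_two_loop_measure case_prod_beta)
qed

lemma absolutely_continuous_two_loop_measure:
  "absolutely_continuous (\<mu> \<Otimes>\<^sub>M \<mu>) (two_loop_measure Pbr c \<mu>)"
  unfolding two_loop_measure_eq_density
  using measurable_w by (intro absolutely_continuousI_density) (simp add: sets_pair_\<mu> cong: measurable_cong_sets)

text \<open>The right-hand side of the relation does not involve \<nu>, so two solutions agree on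
  every measurable set.\<close>

lemma cascade_relation_unique:
  assumes "sets \<nu> = sets (loop_borel \<Otimes>\<^sub>M loop_borel)" "cascade_relation Pbr c \<mu> \<nu>"
  shows "\<nu> = two_loop_measure Pbr c \<mu>"
  using assms cascade_relation_two_loop_measure
  by (intro measure_eqI) (auto simp: sets_two_loop_measure cascade_relation_def)

end

section \<open>Moebius invariance\<close>

lemma inversion_inversion [simp]: "inversion (inversion x) = x"
  by (cases x) auto

text \<open>On coefficient matrices, \<open>inversion\<close> after the map swaps the rows, and
  before it the columns. The determinant condition rules out that numerator and denominator vanish
  together.\<close>

lemma inversion_moebius_map:
  assumes "a * d - b * c \<noteq> 0"
  shows "inversion (moebius_map a b c d x) = moebius_map c d a b x"
proof (cases x)
  case (Fin z)
  have "a * z + b \<noteq> 0" if "c * z + d = 0"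
  proof
    assume "a * z + b = 0"
    have "a * d - b * c = a * (c * z + d) - c * (a * z + b)" by (simp add: algebra_simps)
    then show False using that \<open>a * z + b = 0\<close> assms by simp
  qed
  then show ?thesis using Fin by auto
qed (use assms in auto)

lemma moebius_map_inversion: "moebius_map a b c d (inversion x) = moebius_map b a d c x"
proof (cases x)
  case (Fin z)
  show ?thesis
  proof (cases "z = 0")
    case False
    then have "c * (1 / z) + d = (d * z + c) / z" "a * (1 / z) + b = (b * z + a) / z"
      by (simp_all add: field_simps)
    then show ?thesis using Fin False by simp
  qed (use Fin in simp)
qed simp

text \<open>The adjugate matrix represents the inverse map, as the determinant cancels in the
  quotient.\<close>

lemma moebius_map_inverse:
  assumes "a * d - b * c \<noteq> 0"
  shows "moebius_map d (- b) (- c) a (moebius_map a b c d x) = x"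
proof (cases x)
  case (Fin z)
  let ?det = "a * d - b * c"
  show ?thesis
  proof (cases "c * z + d = 0")
    case True
    then have "c \<noteq> 0" using assms by auto
    have "d = - (c * z)" using True by (simp add: add_eq_0_iff2)
    then show ?thesis using Fin True \<open>c \<noteq> 0\<close> by simp
  next
    case False
    let ?y = "(a * z + b) / (c * z + d)"
    have "- c * ?y + a = ?det / (c * z + d)" "d * ?y + - b = ?det * z / (c * z + d)"
      using False by (simp_all add: field_simps)
    then show ?thesis using Fin False assms by simp
  qed
next
  case Infty
  show ?thesis
  proof (cases "c = 0")
    case False
    then have "- c * (a / c) + a = 0" by simp
    then show ?thesis using Infty False by simp
  qed (use Infty in simp)
qed

lemma moebius_transformations_cases:
  assumes "\<phi> \<in> moebius_transformations"
  obtains a b c d where "\<phi> = moebius_map a b c d" "a * d - b * c \<noteq> 0"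
  using assms unfolding moebius_transformations_def by blast

text \<open>Every chart expression of a Moebius map is again a Moebius map. Continuity and
  holomorphy thus reduce to finite points with finite images, where the map is a quotient of affine
  functions.\<close>

lemma moebius_transformation_charts:
  assumes "\<phi> \<in> moebius_transformations" "i \<in> {id, inversion}" "j \<in> {id, inversion}"
  shows "(\<lambda>x. j (\<phi> (i x))) \<in> moebius_transformations"
proof -
  have inv: "(\<lambda>x. inversion (\<psi> x)) \<in> moebius_transformations" if "\<psi> \<in> moebius_transformations" for \<psi>
    using that
  proof (cases rule: moebius_transformations_cases)
    case (1 a b c d)
    then have "(\<lambda>x. inversion (\<psi> x)) = moebius_map c d a b" "c * b - d * a \<noteq> 0"
      by (simp_all add: inversion_moebius_map fun_eq_iff algebra_simps)
    then show ?thesis unfolding moebius_transformations_def by blast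
  qed
  have inv': "(\<lambda>x. \<psi> (inversion x)) \<in> moebius_transformations" if "\<psi> \<in> moebius_transformations" for \<psi>
    using that
  proof (cases rule: moebius_transformations_cases)
    case (1 a b c d)
    then have "(\<lambda>x. \<psi> (inversion x)) = moebius_map b a d c" "b * c - a * d \<noteq> 0"
      by (simp_all add: moebius_map_inversion fun_eq_iff algebra_simps)
    then show ?thesis unfolding moebius_transformations_def by blast
  qed
  show ?thesis using assms inv inv' inv[OF inv'] by auto
qed

lemma moebius_transformation_inverse:
  assumes "\<phi> \<in> moebius_transformations"
  obtains \<psi> where "\<psi> \<in> moebius_transformations" "\<And>x. \<psi> (\<phi> x) = x" "\<And>x. \<phi> (\<psi> x) = x"
  using assms
proof (cases rule: moebius_transformations_cases)
  case (1 a b c d)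
  then have *: "d * a - - b * - c \<noteq> 0" by (simp add: algebra_simps)
  then have "moebius_map d (- b) (- c) a \<in> moebius_transformations"
    unfolding moebius_transformations_def by blast
  moreover have "moebius_map d (- b) (- c) a (\<phi> x) = x" for x
    unfolding 1(1) by (rule moebius_map_inverse[OF 1(2)])
  moreover have "\<phi> (moebius_map d (- b) (- c) a x) = x" for x
    using moebius_map_inverse[OF *, of x] 1(1) by simp
  ultimately show thesis using that by blast
qed

text \<open>Under \<open>stereo\<close>, the map \<open>1/z\<close> is the half turn of the unit
  sphere about the real axis; its continuity at 0 and at \<open>Infty\<close> is visible in this
  form.\<close>

lemma stereo_inversion: "stereo (inversion x) = (cnj (fst (stereo x)), - snd (stereo x))"
proof (cases x)
  case (Fin z)
  show ?thesis
  proof (cases "z = 0")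
    case False
    define r where "r = (cmod z)\<^sup>2"
    have r: "r > 0" using False by (simp add: r_def)
    have z: "1 / z = cnj z /\<^sub>R r"
      using complex_div_cnj[of 1 z] by (simp add: r_def scaleR_conv_of_real divide_inverse mult.commute)
    have "(cmod (1 / z))\<^sup>2 = 1 / r"
      unfolding r_def norm_divide power_divide by simp
    then have "stereo (Fin (1 / z)) = ((2 / (1 + 1 / r)) *\<^sub>R (1 / z), (1 / r - 1) / (1 / r + 1))"
      by simp
    moreover have "2 / (1 + 1 / r) * inverse r = 2 / (1 + r)"
    proof -
      have "1 + 1 / r = (1 + r) / r" using r by (simp add: field_simps)
      then show ?thesis using r by simp
    qed
    moreover have "(1 / r - 1) / (1 / r + 1) = - ((r - 1) / (r + 1))"
    proof -
      have "1 / r + 1 = (r + 1) / r" "1 / r - 1 = - (r - 1) / r" using r by (simp_all add: field_simps)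
      then show ?thesis using r by (simp only: minus_divide_left) simp
    qed
    ultimately have "stereo (Fin (1 / z)) = ((2 / (1 + r)) *\<^sub>R cnj z, - ((r - 1) / (r + 1)))"
      unfolding z scaleR_scaleR by (simp only:)
    then show ?thesis using Fin False by (simp add: r_def)
  qed (use Fin in simp)
qed simp

lemma continuous_on_rsphereI:
  fixes S :: "'a::metric_space set"
  shows "continuous_on S (\<lambda>x. stereo (f x)) \<Longrightarrow> continuous_on S f"
  by (simp add: continuous_on_iff dist_rsphere_def)

lemma continuous_on_inversion: "continuous_on S inversion"
  by (rule continuous_on_rsphereI) (auto simp: stereo_inversion intro!: continuous_intros)

lemma open_Fin_image:
  assumes "open U" shows "open (Fin ` U)"
proof -
  have "open (- {Infty})" by (simp add: open_Compl)
  then have "open (- {Infty} \<inter> affine_part -` U)"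
    using continuous_open_preimage[OF continuous_on_affine_part _ assms] by simp
  moreover have "- {Infty} \<inter> affine_part -` U = Fin ` U"
  proof (intro set_eqI)
    show "x \<in> - {Infty} \<inter> affine_part -` U \<longleftrightarrow> x \<in> Fin ` U" for x by (cases x) auto
  qed
  ultimately show ?thesis by simp
qed

lemma moebius_transformation_affine_chart:
  assumes "\<psi> \<in> moebius_transformations"
  obtains a b c d where "\<And>z. \<psi> (Fin z) \<noteq> Infty \<longleftrightarrow> c * z + d \<noteq> 0"
    "\<And>z. c * z + d \<noteq> 0 \<Longrightarrow> \<psi> (Fin z) = Fin ((a * z + b) / (c * z + d))"
proof -
  obtain a b c d where "\<psi> = moebius_map a b c d"
    using assms by (rule moebius_transformations_cases)
  then show thesis using that[of c d a b] by simp
qed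

lemma isCont_moebius_transformation_finite:
  assumes "\<psi> \<in> moebius_transformations" "\<psi> (Fin z) \<noteq> Infty"
  shows "isCont \<psi> (Fin z)"
proof -
  obtain a b c d where *: "\<And>z. \<psi> (Fin z) \<noteq> Infty \<longleftrightarrow> c * z + d \<noteq> 0"
    "\<And>z. c * z + d \<noteq> 0 \<Longrightarrow> \<psi> (Fin z) = Fin ((a * z + b) / (c * z + d))"
    using moebius_transformation_affine_chart[OF assms(1)] by metis
  define U where "U = {z. c * z + d \<noteq> 0}"
  have "open U" unfolding U_def by (intro open_Collect_neq continuous_intros)
  have "continuous_on U (\<lambda>z. (a * z + b) / (c * z + d))"
    by (intro continuous_intros) (auto simp: U_def)
  then have "continuous_on (Fin ` U) (\<lambda>x. (a * affine_part x + b) / (c * affine_part x + d))"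
    by (rule continuous_on_compose2[OF _ continuous_on_affine_part]) auto
  then have "continuous_on (Fin ` U) (\<lambda>x. Fin ((a * affine_part x + b) / (c * affine_part x + d)))"
    by (rule continuous_on_compose2[OF continuous_on_Fin[of UNIV]]) auto
  moreover have "Fin ((a * affine_part x + b) / (c * affine_part x + d)) = \<psi> x" if "x \<in> Fin ` U" for x
    using that *(2) by (auto simp: U_def)
  ultimately have "continuous_on (Fin ` U) \<psi>" by (simp cong: continuous_on_cong_simp)
  then show ?thesis
    using open_Fin_image[OF \<open>open U\<close>] *(1) assms(2)
    by (simp add: continuous_on_eq_continuous_at U_def)
qed

text \<open>Charts \<open>i\<close> and \<open>j\<close> are chosen so that the point and its image
  become finite. Since \<open>id\<close> and \<open>inversion\<close> are involutions, \<phi> is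
  recovered from its chart expression.\<close>

lemma continuous_on_moebius_transformation:
  assumes "\<phi> \<in> moebius_transformations" shows "continuous_on S \<phi>"
proof -
  have "isCont \<phi> x" for x
  proof -
    have chart: "\<exists>i\<in>{id, inversion}. i y \<noteq> Infty" for y by (cases y) auto
    obtain i where i: "i \<in> {id, inversion}" "i x \<noteq> Infty" using chart by blast
    obtain j where j: "j \<in> {id, inversion}" "j (\<phi> x) \<noteq> Infty" using chart by blast
    have invol: "f (f y) = y" and cont: "isCont f y" if "f \<in> {id, inversion}" for f :: "rsphere \<Rightarrow> rsphere" and y
      using that continuous_on_inversion[of UNIV] by (auto simp: continuous_on_eq_continuous_at)
    define \<psi> where "\<psi> y = j (\<phi> (i y))" for y
    have \<psi>: "\<psi> \<in> moebius_transformations"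
      using moebius_transformation_charts[OF assms i(1) j(1)] by (simp add: \<psi>_def[abs_def])
    obtain z where z: "i x = Fin z" using i(2) by (cases "i x") auto
    have "\<psi> (Fin z) \<noteq> Infty" using j(2) invol[OF i(1)] by (simp add: \<psi>_def z[symmetric])
    then have "isCont \<psi> (i x)" unfolding z by (rule isCont_moebius_transformation_finite[OF \<psi>])
    then have "isCont (\<lambda>y. j (\<psi> (i y))) x"
      by (intro isCont_o2[OF isCont_o2[OF cont[OF i(1)]] cont[OF j(1)]])
    then show ?thesis by (simp add: \<psi>_def invol[OF i(1)] invol[OF j(1)])
  qed
  then show ?thesis by (simp add: continuous_at_imp_continuous_on)
qed

lemma rsphere_holomorphic_on_moebius_transformation:
  assumes "\<phi> \<in> moebius_transformations" shows "rsphere_holomorphic_on \<phi> D"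
  unfolding rsphere_holomorphic_on_def
proof (intro conjI ballI continuous_on_moebius_transformation[OF assms])
  fix i j assume ij: "i \<in> {id, inversion}" "j \<in> {id, inversion}"
  define \<psi> where "\<psi> y = j (\<phi> (i y))" for y
  have "\<psi> \<in> moebius_transformations"
    using moebius_transformation_charts[OF assms ij] by (simp add: \<psi>_def[abs_def])
  then obtain a b c d where *: "\<And>z. \<psi> (Fin z) \<noteq> Infty \<longleftrightarrow> c * z + d \<noteq> 0"
    "\<And>z. c * z + d \<noteq> 0 \<Longrightarrow> \<psi> (Fin z) = Fin ((a * z + b) / (c * z + d))"
    using moebius_transformation_affine_chart by metis
  have "(\<lambda>z. (a * z + b) / (c * z + d)) holomorphic_on {z. i (Fin z) \<in> D \<and> \<psi> (Fin z) \<noteq> Infty}"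
    by (intro holomorphic_intros) (use * in auto)
  then have "(\<lambda>z. affine_part (\<psi> (Fin z))) holomorphic_on {z. i (Fin z) \<in> D \<and> \<psi> (Fin z) \<noteq> Infty}"
    by (rule holomorphic_transform) (use * in auto)
  then show "(\<lambda>z. affine_part (j (\<phi> (i (Fin z))))) holomorphic_on {z. i (Fin z) \<in> D \<and> j (\<phi> (i (Fin z))) \<noteq> Infty}"
    by (simp add: \<psi>_def)
qed

section \<open>Action of Moebius maps on domains, components and loop measures\<close>

lemma bij_moebius_transformation:
  assumes "\<phi> \<in> moebius_transformations" shows "bij \<phi>"
proof -
  obtain \<psi> where \<psi>: "\<psi> \<in> moebius_transformations" "\<And>x. \<psi> (\<phi> x) = x" "\<And>x. \<phi> (\<psi> x) = x"
    by (rule moebius_transformation_inverse[OF assms]) blast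
  show ?thesis using inj_on_inverseI[of UNIV \<psi> \<phi>] surjI[of \<phi> \<psi>] \<psi>(2,3) by (simp add: bij_def)
qed

lemma conformal_map_moebius_transformation:
  assumes "\<phi> \<in> moebius_transformations" shows "conformal_map D (\<phi> ` D) \<phi>"
  unfolding conformal_map_def
  using rsphere_holomorphic_on_moebius_transformation[OF assms]
    inj_on_imp_bij_betw[OF inj_on_subset[OF bij_is_inj[OF bij_moebius_transformation[OF assms]] subset_UNIV]]
  by blast

lemma open_moebius_image:
  assumes "\<phi> \<in> moebius_transformations" "open D" shows "open (\<phi> ` D)"
proof -
  obtain \<psi> where \<psi>: "\<psi> \<in> moebius_transformations" "\<And>x. \<psi> (\<phi> x) = x" "\<And>x. \<phi> (\<psi> x) = x"
    by (rule moebius_transformation_inverse[OF assms(1)]) blast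
  have "\<phi> ` D = \<psi> -` D" 
  proof (intro set_eqI iffI)
    show "x \<in> \<psi> -` D" if "x \<in> \<phi> ` D" for x using that \<psi>(2) by auto
    show "x \<in> \<phi> ` D" if "x \<in> \<psi> -` D" for x using imageI[of "\<psi> x" D \<phi>] that \<psi>(3) by simp
  qed
  then show ?thesis
    using open_vimage[OF assms(2) continuous_on_moebius_transformation[OF \<psi>(1)]] by simp
qed

lemma rsphere_domain_moebius_image:
  assumes "\<phi> \<in> moebius_transformations" "rsphere_domain D" shows "rsphere_domain (\<phi> ` D)"
  using assms(2) open_moebius_image[OF assms(1)]
    connected_continuous_image[OF continuous_on_moebius_transformation[OF assms(1)]]
  by (simp add: rsphere_domain_def)

text \<open>The continuous inverse carries a connected set between the images of \<open>D\<close>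
  and \<open>S\<close> back to one between \<open>D\<close> and \<open>S\<close>, so maximality
  transfers.\<close>

lemma components_moebius_image_subset:
  assumes "\<phi> \<in> moebius_transformations" "D \<in> components S" shows "\<phi> ` D \<in> components (\<phi> ` S)"
proof -
  obtain \<psi> where \<psi>: "\<psi> \<in> moebius_transformations" "\<And>x. \<psi> (\<phi> x) = x" "\<And>x. \<phi> (\<psi> x) = x"
    by (rule moebius_transformation_inverse[OF assms(1)]) blast
  have D: "D \<noteq> {}" "D \<subseteq> S" "connected D" "\<And>E. E \<noteq> {} \<Longrightarrow> D \<subseteq> E \<Longrightarrow> E \<subseteq> S \<Longrightarrow> connected E \<Longrightarrow> E = D"
    using iffD1[OF in_components_maximal assms(2)] by simp_all
  have "E = \<phi> ` D" if E: "E \<noteq> {}" "\<phi> ` D \<subseteq> E" "E \<subseteq> \<phi> ` S" "connected E" for E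
  proof -
    have "\<psi> ` E = D"
    proof (rule D(4))
      show "D \<subseteq> \<psi> ` E" using image_mono[OF E(2), of \<psi>] by (simp add: image_image \<psi>(2))
      show "\<psi> ` E \<subseteq> S" using image_mono[OF E(3), of \<psi>] by (simp add: image_image \<psi>(2))
      show "connected (\<psi> ` E)"
        by (rule connected_continuous_image[OF continuous_on_moebius_transformation[OF \<psi>(1)] E(4)])
    qed (use E(1) in simp)
    then have "\<phi> ` \<psi> ` E = \<phi> ` D" by simp
    then show ?thesis by (simp add: image_image \<psi>(3))
  qed
  moreover have "connected (\<phi> ` D)"
    by (rule connected_continuous_image[OF continuous_on_moebius_transformation[OF assms(1)] D(3)])
  ultimately show ?thesis
    using D(1) image_mono[OF D(2), of \<phi>] by (intro iffD2[OF in_components_maximal]) blast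
qed

lemma components_moebius_image:
  assumes "\<phi> \<in> moebius_transformations" shows "components (\<phi> ` S) = (\<lambda>D. \<phi> ` D) ` components S"
proof -
  obtain \<psi> where \<psi>: "\<psi> \<in> moebius_transformations" "\<And>x. \<psi> (\<phi> x) = x" "\<And>x. \<phi> (\<psi> x) = x"
    by (rule moebius_transformation_inverse[OF assms]) blast
  have "E \<in> (\<lambda>D. \<phi> ` D) ` components S" if "E \<in> components (\<phi> ` S)" for E
  proof
    show "E = \<phi> ` \<psi> ` E" by (simp add: image_image \<psi>)
    show "\<psi> ` E \<in> components S"
      using components_moebius_image_subset[OF \<psi>(1) that] by (simp add: image_image \<psi>)
  qed
  then show ?thesis using components_moebius_image_subset[OF assms] by blast
qed

text \<open>Makes \<open>\<mu>_in UNIV\<close> equal to \<mu>, so that Moebius invariance of \<mu>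
  is an instance of conformal invariance in domains.\<close>

lemma polar_empty: "polar {}"
  unfolding polar_def by auto

text \<open>The inner integral is handled componentwise: \<phi> maps the components of the
  complement of \<open>\<gamma>1\<close> bijectively to those of the complement of its image, and
  conformal invariance carries the loop measure in each to the loop measure in its image. The outer
  integral is then moved by the invariance of \<mu>. The weight is never compared with the weight of
  the transformed pair.\<close>

lemma (in loop_measure) moebius_invariant_two_loop_measure:
  assumes conf: "\<And>D1 D2 \<psi>. rsphere_domain D1 \<Longrightarrow> rsphere_domain D2 \<Longrightarrow> conformal_map D1 D2 \<psi> \<Longrightarrow>
      distr (\<mu>_in D1) (restrict_space loop_borel {\<gamma>. \<gamma> \<subseteq> D2}) (\<lambda>\<gamma>. \<psi> ` \<gamma>) = \<mu>_in D2"
  shows "moebius_invariant (two_loop_measure Pbr c \<mu>)"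
  unfolding moebius_invariant_def
proof
  fix \<phi> assume \<phi>: "\<phi> \<in> moebius_transformations"
  have inj: "inj \<phi>" and bij: "bij \<phi>" using bij_moebius_transformation[OF \<phi>] by (auto simp: bij_def)
  have \<phi>m [measurable]: "(\<lambda>\<gamma>. \<phi> ` \<gamma>) \<in> loop_borel \<rightarrow>\<^sub>M loop_borel"
    by (rule measurable_loop_image[OF continuous_on_moebius_transformation[OF \<phi>] inj])
  have \<phi>_in: "distr (\<mu>_in D) (restrict_space loop_borel {\<gamma>. \<gamma> \<subseteq> \<phi> ` D}) (\<lambda>\<gamma>. \<phi> ` \<gamma>) = \<mu>_in (\<phi> ` D)"
    if "rsphere_domain D" for D
    by (rule conf[OF that rsphere_domain_moebius_image[OF \<phi> that] conformal_map_moebius_transformation[OF \<phi>]])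
  have \<mu>_UNIV: "\<mu>_in UNIV = \<mu>"
  proof (rule measure_eqI)
    show "sets (\<mu>_in UNIV) = sets \<mu>"
      by (simp add: sets_loop_measure_in sets_\<mu> sets_restrict_UNIV)
    have "\<mu>_in UNIV = density (restrict_space \<mu> UNIV) (\<lambda>_. 1)"
      by (simp add: loop_measure_in_def polar_empty)
    then show "emeasure (\<mu>_in UNIV) X = emeasure \<mu> X" if "X \<in> sets (\<mu>_in UNIV)" for X
      using that by (simp add: density_1 emeasure_restrict_space sets_restrict_UNIV)
  qed
  have \<phi>_\<mu>: "distr \<mu> loop_borel (\<lambda>\<gamma>. \<phi> ` \<gamma>) = \<mu>"
  proof -
    have "rsphere_domain UNIV" by (simp add: rsphere_domain_def connected_UNIV_rsphere)
    from \<phi>_in[OF this] have "distr \<mu> (restrict_space loop_borel UNIV) (\<lambda>\<gamma>. \<phi> ` \<gamma>) = \<mu>"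
      using bij by (simp add: \<mu>_UNIV bij_is_surj)
    moreover have "distr \<mu> (restrict_space loop_borel UNIV) (\<lambda>\<gamma>. \<phi> ` \<gamma>) = distr \<mu> loop_borel (\<lambda>\<gamma>. \<phi> ` \<gamma>)"
      by (rule distr_cong) (simp_all add: sets_restrict_UNIV)
    ultimately show ?thesis by simp
  qed
  let ?T = "\<lambda>(\<gamma>1, \<gamma>2). (\<phi> ` \<gamma>1, \<phi> ` \<gamma>2)"
  let ?\<nu> = "two_loop_measure Pbr c \<mu>"
  have T: "?T \<in> loop_borel \<Otimes>\<^sub>M loop_borel \<rightarrow>\<^sub>M loop_borel \<Otimes>\<^sub>M loop_borel"
    by measurable
  have Tm: "?T \<in> ?\<nu> \<rightarrow>\<^sub>M loop_borel \<Otimes>\<^sub>M loop_borel"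
    using T by (simp add: sets_two_loop_measure cong: measurable_cong_sets)
  show "distr ?\<nu> (loop_borel \<Otimes>\<^sub>M loop_borel) ?T = ?\<nu>"
  proof (rule measure_eqI)
    show "sets (distr ?\<nu> (loop_borel \<Otimes>\<^sub>M loop_borel) ?T) = sets ?\<nu>"
      by (simp add: sets_two_loop_measure)
    fix A assume "A \<in> sets (distr ?\<nu> (loop_borel \<Otimes>\<^sub>M loop_borel) ?T)"
    then have A: "A \<in> sets (loop_borel \<Otimes>\<^sub>M loop_borel)" by simp
    define A' where "A' = ?T -` A \<inter> space (loop_borel \<Otimes>\<^sub>M loop_borel)"
    have A': "A' \<in> sets (loop_borel \<Otimes>\<^sub>M loop_borel)"
      unfolding A'_def by (rule measurable_sets[OF T A])
    \<comment> \<open>By \<open>cascade_sum\<close>, the total measure, over the components of the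
      complement of \<open>\<gamma>1\<close>, of the section of \<open>A\<close> at
      \<open>\<gamma>1\<close>.\<close>
    define F where "F \<gamma>1 = (\<integral>\<^sup>+ \<gamma>2. w (\<gamma>1, \<gamma>2) * indicator A (\<gamma>1, \<gamma>2) \<partial>\<mu>)" for \<gamma>1
    have "(\<lambda>p. w p * indicator A p) \<in> borel_measurable (loop_borel \<Otimes>\<^sub>M loop_borel)"
      by (intro borel_measurable_times_ennreal measurable_w borel_measurable_indicator A)
    then have "(\<lambda>p. w p * indicator A p) \<in> borel_measurable (loop_borel \<Otimes>\<^sub>M \<mu>)"
      using sets_pair_measure_cong[OF refl sets_\<mu>] by (simp cong: measurable_cong_sets)
    then have Fm: "F \<in> borel_measurable loop_borel"
      unfolding F_def by (rule borel_measurable_nn_integral_fst)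
    have step: "(\<integral>\<^sup>+ \<gamma>2. w (\<gamma>1, \<gamma>2) * indicator A' (\<gamma>1, \<gamma>2) \<partial>\<mu>) = F (\<phi> ` \<gamma>1)"
      if \<gamma>1: "\<gamma>1 \<in> simple_loops" for \<gamma>1
    proof -
      have \<phi>\<gamma>1: "\<phi> ` \<gamma>1 \<in> simple_loops"
        by (rule simple_loops_image[OF \<gamma>1 continuous_on_moebius_transformation[OF \<phi>] inj])
      have op: "open (- \<gamma>1)" using simple_loops_compact[OF \<gamma>1] by (auto intro: compact_imp_closed)
      \<comment> \<open>Conformal invariance on a single component: \<open>A'\<close> is the
        preimage of \<open>A\<close>, so its section at \<open>\<gamma>1\<close> is the preimage
        under \<phi> of the section of \<open>A\<close> at the image loop.\<close>
      have comp: "emeasure (\<mu>_in (\<phi> ` D)) {\<gamma>2\<in>space (\<mu>_in (\<phi> ` D)). (\<phi> ` \<gamma>1, \<gamma>2) \<in> A}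
          = emeasure (\<mu>_in D) {\<gamma>2\<in>space (\<mu>_in D). (\<gamma>1, \<gamma>2) \<in> A'}" (is "emeasure _ ?X = emeasure _ ?Y")
        if D: "D \<in> components (- \<gamma>1)" for D
      proof -
        have dom: "rsphere_domain D"
          using D open_components_rsphere[OF op D] in_components_connected in_components_nonempty
          by (auto simp: rsphere_domain_def)
        let ?N = "restrict_space loop_borel {\<gamma>. \<gamma> \<subseteq> \<phi> ` D}"
        have m: "(\<lambda>\<gamma>. \<phi> ` \<gamma>) \<in> \<mu>_in D \<rightarrow>\<^sub>M ?N"
        proof (rule measurable_restrict_space2)
          show "(\<lambda>\<gamma>. \<phi> ` \<gamma>) \<in> space (\<mu>_in D) \<rightarrow> {\<gamma>. \<gamma> \<subseteq> \<phi> ` D}"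
            by (auto simp: space_loop_measure_in)
          show "(\<lambda>\<gamma>. \<phi> ` \<gamma>) \<in> \<mu>_in D \<rightarrow>\<^sub>M loop_borel"
            using measurable_restrict_space1[OF \<phi>m, of "{\<gamma>. \<gamma> \<subseteq> D}"]
            by (simp add: sets_loop_measure_in cong: measurable_cong_sets)
        qed
        have "Pair (\<phi> ` \<gamma>1) \<in> loop_borel \<rightarrow>\<^sub>M loop_borel \<Otimes>\<^sub>M loop_borel"
          using \<phi>\<gamma>1 by (intro measurable_Pair) (simp_all add: space_loop_borel)
        from measurable_sets[OF measurable_restrict_space1[OF this] A, of "{\<gamma>. \<gamma> \<subseteq> \<phi> ` D}"]
        have X: "?X \<in> sets ?N"
          by (simp add: vimage_def Int_def conj_commute space_loop_measure_in space_restrict_space space_loop_borel)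
        have "(\<lambda>\<gamma>. \<phi> ` \<gamma>) -` ?X \<inter> space (\<mu>_in D) = ?Y"
          using \<gamma>1 simple_loops_image[OF _ continuous_on_moebius_transformation[OF \<phi>] inj]
          by (auto simp: space_loop_measure_in A'_def space_pair_measure space_loop_borel)
        then show ?thesis
          using emeasure_distr[OF m X] \<phi>_in[OF dom] by simp
      qed
      have "components (- \<phi> ` \<gamma>1) = (\<lambda>D. \<phi> ` D) ` components (- \<gamma>1)"
        using components_moebius_image[OF \<phi>, of "- \<gamma>1"] bij_image_Compl_eq[OF bij] by metis
      moreover have "inj_on (\<lambda>D. \<phi> ` D) (components (- \<gamma>1))"
        using inj by (meson inj_image_eq_iff inj_onI)
      ultimately have bb: "bij_betw (\<lambda>D. \<phi> ` D) (components (- \<gamma>1)) (components (- \<phi> ` \<gamma>1))"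
        by (simp add: bij_betw_def)
      have "F (\<phi> ` \<gamma>1) = (\<Sum>\<^sub>\<infinity>D\<in>components (- \<phi> ` \<gamma>1). emeasure (\<mu>_in D) {\<gamma>2\<in>space (\<mu>_in D). (\<phi> ` \<gamma>1, \<gamma>2) \<in> A})"
        unfolding F_def by (rule cascade_sum[OF \<phi>\<gamma>1 A, symmetric])
      also have "\<dots> = (\<Sum>\<^sub>\<infinity>D\<in>components (- \<gamma>1). emeasure (\<mu>_in (\<phi> ` D)) {\<gamma>2\<in>space (\<mu>_in (\<phi> ` D)). (\<phi> ` \<gamma>1, \<gamma>2) \<in> A})"
        by (rule infsum_reindex_bij_betw[OF bb, symmetric])
      also have "\<dots> = (\<Sum>\<^sub>\<infinity>D\<in>components (- \<gamma>1). emeasure (\<mu>_in D) {\<gamma>2\<in>space (\<mu>_in D). (\<gamma>1, \<gamma>2) \<in> A'})"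
        by (intro infsum_cong comp)
      also have "\<dots> = (\<integral>\<^sup>+ \<gamma>2. w (\<gamma>1, \<gamma>2) * indicator A' (\<gamma>1, \<gamma>2) \<partial>\<mu>)"
        by (rule cascade_sum[OF \<gamma>1 A'])
      finally show ?thesis by simp
    qed
    have "emeasure (distr ?\<nu> (loop_borel \<Otimes>\<^sub>M loop_borel) ?T) A = emeasure ?\<nu> A'"
      using sets_eq_imp_space_eq[OF sets_two_loop_measure] by (simp add: emeasure_distr[OF Tm A] A'_def)
    also have "\<dots> = (\<integral>\<^sup>+ \<gamma>1. F (\<phi> ` \<gamma>1) \<partial>\<mu>)"
      unfolding emeasure_two_loop_measure[OF A'] by (intro nn_integral_cong step) (simp add: space_\<mu>)
    also have "\<dots> = (\<integral>\<^sup>+ \<gamma>1. F \<gamma>1 \<partial>distr \<mu> loop_borel (\<lambda>\<gamma>. \<phi> ` \<gamma>))"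
      by (rule nn_integral_distr[symmetric]) (use Fm \<phi>m in \<open>simp_all add: sets_\<mu> cong: measurable_cong_sets\<close>)
    also have "\<dots> = emeasure ?\<nu> A"
      unfolding \<phi>_\<mu> emeasure_two_loop_measure[OF A] F_def ..
    finally show "emeasure (distr ?\<nu> (loop_borel \<Otimes>\<^sub>M loop_borel) ?T) A = emeasure ?\<nu> A" .
  qed
qed

theorem theorem2p1:
  fixes \<kappa> c :: real
    and Pbr :: "complex \<Rightarrow> real \<Rightarrow> (real \<Rightarrow> complex) measure"
    and \<mu> :: "rsphere set measure"
  assumes "0 < \<kappa>" and "\<kappa> \<le> 4"
    and "c = central_charge \<kappa>"
    and "\<And>z t. 0 < t \<Longrightarrow> brownian_bridge_law z t (Pbr z t)"
    and "SLE_loop_measure Pbr \<kappa> \<mu>"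
  shows "disjoint_loop_pair_measure (two_loop_measure Pbr c \<mu>)
       \<and> moebius_invariant (two_loop_measure Pbr c \<mu>)
       \<and> absolutely_continuous (\<mu> \<Otimes>\<^sub>M \<mu>) (two_loop_measure Pbr c \<mu>)
       \<and> cascade_relation Pbr c \<mu> (two_loop_measure Pbr c \<mu>)
       \<and> (\<forall>\<nu>. disjoint_loop_pair_measure \<nu> \<and> moebius_invariant \<nu>
              \<and> absolutely_continuous (\<mu> \<Otimes>\<^sub>M \<mu>) \<nu> \<and> cascade_relation Pbr c \<mu> \<nu>
            \<longrightarrow> \<nu> = two_loop_measure Pbr c \<mu>)"
proof -
  interpret loop_measure Pbr c \<mu>
    using assms(4,5) by unfold_locales (auto simp: SLE_loop_measure_def)
  have "moebius_invariant (two_loop_measure Pbr c \<mu>)"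
    by (rule moebius_invariant_two_loop_measure) (use assms(3,5) in \<open>auto simp: SLE_loop_measure_def\<close>)
  then show ?thesis
    using disjoint_loop_pair_measure_two_loop_measure absolutely_continuous_two_loop_measure
      cascade_relation_two_loop_measure cascade_relation_unique
    unfolding disjoint_loop_pair_measure_def by blast
qed

end
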